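(* Let $\rho>\max\{0,-\alpha\}$, $0<\gamma<\sigma\le 1$, $p>1$, $\frac1p+\frac1q=1$. Let $f(x)\ge 0$ ($x\in\mathbf{R}_+$) be measurable and $a_n\ge 0$ ($n\in\mathbf{N}$), with $0<\|f\|_{p,\Phi_\delta}<\infty$ and $0<\|a\|_{q,\Psi_\beta}<\infty$. Then the following equivalent inequalities hold: $$\sum_{n=1}^\infty\int_0^\infty K_\delta(x,n)\,a_n f(x)\,dx<k(\sigma)\,\|f\|_{p,\Phi_\delta}\|a\|_{q,\Psi_\beta},$$ $$\left\{\sum_{n=1}^\infty\frac{\nu_{n+1}}{(V_n-\beta)^{1-p\sigma}}\left[\int_0^\infty K_\delta(x,n)f(x)\,dx\right]^p\right\}^{1/p}<k(\sigma)\,\|f\|_{p,\Phi_\delta},$$ $$\left\{\int_0^\infty\frac{\mu(x)}{U^{1-q\delta\sigma}(x)}\left[\sum_{n=1}^\infty K_\delta(x,n)a_n\right]^q dx\right\}^{1/q}<k(\sigma)\,\|a\|_{q,\Psi_\beta}.$$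
   Context: Setting. $\mathbf{R}_+=(0,\infty)$, $\mathbf{N}=\{1,2,\dots\}$, and $\alpha,\rho,\gamma,\sigma,\beta$ are real. $\{\nu_n\}_{n\ge1}$ is a decreasing (i.e. $\nu_{n+1}\le\nu_n$) sequence of positive reals, $V_n=\sum_{j=1}^n\nu_j$, and $\beta\le\nu_1/2$. $\mu$ is a positive continuous function on $\mathbf{R}_+$ with $U(x):=\int_0^x\mu(t)\,dt<\infty$ for all $x>0$. $\delta\in\{-1,1\}$ is fixed. Powers such as $U^{s}(x)$ mean $(U(x))^{s}$. Kernel: with $\operatorname{csch}(u)=\frac{2}{e^u-e^{-u}}$ ($u>0$), $$K_\delta(x,n):=\frac{\operatorname{csch}\big(\rho\,U^{\delta\gamma}(x)(V_n-\beta)^\gamma\big)}{e^{\alpha U^{\delta\gamma}(x)(V_n-\beta)^\gamma}}.$$ Constant: $$k(\sigma):=\int_0^\infty\frac{\operatorname{csch}(\rho t^\gamma)}{e^{\alpha t^\gamma}}t^{\sigma-1}dt=\frac{2\Gamma(\sigma/\gamma)}{\gamma(2\rho)^{\sigma/\gamma}}\,\zeta\!\left(\frac{\sigma}{\gamma},\frac{\alpha+\rho}{2\rho}\right),$$ where $\zeta(s,a)=\sum_{k=0}^\infty (k+a)^{-s}$ ($s>1$, $a>0$) is the Hurwitz zeta function. Norms: $\Phi_\delta(x):=\frac{U^{p(1-\delta\sigma)-1}(x)}{\mu^{p-1}(x)}$, $\Psi_\beta(n):=\frac{(V_n-\beta)^{q(1-\sigma)-1}}{\nu_{n+1}^{q-1}}$,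 $\|f\|_{p,\Phi_\delta}=\left(\int_0^\infty\Phi_\delta(x)f^p(x)\,dx\right)^{1/p}$, $\|a\|_{q,\Psi_\beta}=\left(\sum_{n=1}^\infty\Psi_\beta(n)a_n^q\right)^{1/q}$. *)

theory Defs
  imports "HOL-Analysis.Analysis"
begin

definition csch :: "real \<Rightarrow> real" where
  "csch u = 2 / (exp u - exp (- u))"

(* Real powers of extended nonnegative numbers.  Only used with exponents r > 0,
   where 0 is mapped to 0 and \<infinity> to \<infinity>. *)
definition epowr :: "ennreal \<Rightarrow> real \<Rightarrow> ennreal" where
  "epowr x r = (if x = \<infinity> then \<infinity> else ennreal (enn2real x powr r))"

(* Sequences are functions on nat of which only the values at indices n \<ge> 1 matter. *)
definition V :: "(nat \<Rightarrow> real) \<Rightarrow> nat \<Rightarrow> real" where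
  "V \<nu> n = (\<Sum>j=1..n. \<nu> j)"

definition U :: "(real \<Rightarrow> real) \<Rightarrow> real \<Rightarrow> real" where
  "U \<mu> x = (LBINT t:{0<..<x}. \<mu> t)"

definition K_ker ::
  "real \<Rightarrow> real \<Rightarrow> real \<Rightarrow> real \<Rightarrow> real \<Rightarrow> (real \<Rightarrow> real) \<Rightarrow> (nat \<Rightarrow> real) \<Rightarrow> real \<Rightarrow> nat \<Rightarrow> real" where
  "K_ker \<alpha> \<rho> \<gamma> \<delta> \<beta> \<mu> \<nu> x n =
     csch (\<rho> * U \<mu> x powr (\<delta> * \<gamma>) * (V \<nu> n - \<beta>) powr \<gamma>)
       / exp (\<alpha> * U \<mu> x powr (\<delta> * \<gamma>) * (V \<nu> n - \<beta>) powr \<gamma>)"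

definition k_const :: "real \<Rightarrow> real \<Rightarrow> real \<Rightarrow> real \<Rightarrow> real" where
  "k_const \<alpha> \<rho> \<gamma> \<sigma> =
     (LBINT t:{0<..}. csch (\<rho> * t powr \<gamma>) / exp (\<alpha> * t powr \<gamma>) * t powr (\<sigma> - 1))"

definition \<Phi> :: "real \<Rightarrow> real \<Rightarrow> real \<Rightarrow> (real \<Rightarrow> real) \<Rightarrow> real \<Rightarrow> real" where
  "\<Phi> p \<sigma> \<delta> \<mu> x = U \<mu> x powr (p * (1 - \<delta> * \<sigma>) - 1) / \<mu> x powr (p - 1)"

definition \<Psi> :: "real \<Rightarrow> real \<Rightarrow> real \<Rightarrow> (nat \<Rightarrow> real) \<Rightarrow> nat \<Rightarrow> real" where
  "\<Psi> q \<sigma> \<beta> \<nu> n = (V \<nu> n - \<beta>) powr (q * (1 - \<sigma>) - 1) / \<nu> (n + 1) powr (q - 1)"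

(* The weighted norms take values in [0,\<infinity>]; a divergent integral or series gives \<infinity>.
   Functions are measurable in the Lebesgue sense, hence the measure lebesgue_on {0<..}. *)
definition norm_fun :: "real \<Rightarrow> (real \<Rightarrow> real) \<Rightarrow> (real \<Rightarrow> real) \<Rightarrow> ennreal" where
  "norm_fun p w f =
     epowr (\<integral>\<^sup>+x. ennreal (w x * f x powr p) \<partial>(lebesgue_on {0<..})) (1 / p)"

definition norm_seq :: "real \<Rightarrow> (nat \<Rightarrow> real) \<Rightarrow> (nat \<Rightarrow> real) \<Rightarrow> ennreal" where
  "norm_seq q w a = epowr (\<Sum>\<^sub>\<infinity>n\<in>{1..}. ennreal (w n * a n powr q)) (1 / q)"

end

(*
  The double series is a bilinear form with kernel K(x,n) = h(U(x)^delta W_n), where W_n = V_n - beta and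
  h(t) = csch(rho t^gamma) exp(-alpha t^gamma), and all three inequalities come from a weighted Schur test
  with constant k(sigma), for which two weight estimates are needed.

  The integral over x reduces by the substitution t = U(x)^delta W_n to an integral of g(t) = h(t) t^(sigma-1)
  over a subset of (0,oo), so it is at most k(sigma).

  The sum over n is a sum of nu_{n+1} g(W_n) (after scaling).  As g decreases, comparing it with the integral of
  g over [W_n, W_{n+1}] would go the wrong way; instead g is convex, and nu_{n+1} g(W_n) is less than the
  integral over the interval of length nu_{n+1} centred at W_n.  These intervals are disjoint because nu is
  decreasing, and contained in (0,oo) because beta <= nu_1 / 2.  So the sum is strictly less than k(sigma),
  which makes the final inequalities strict.
*)
theory Submission
  imports Defs
begin

section \<open>Powers of extended nonnegative reals and Hoelder's inequality\<close>

text \<open>Integrals and series are taken in [0,\<infinity>], so sums and integrals are exchanged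
  freely and convergence is part of the conclusions. Convexity of g is not derived from second
  derivatives. Log-convexity survives products and the composition of a decreasing log-convex
  function with the concave t^\<gamma>, so it is checked factor by factor; AM-GM then gives the
  strict midpoint inequality because g is strictly decreasing. This is where \<gamma> \<le> 1 and
  \<sigma> \<le> 1 enter. The condition \<gamma> < \<sigma> pays for the pole h(t) ~ 1/(\<rho>
  t^\<gamma>) at 0, and \<alpha> + \<rho> > 0 gives the decay at infinity; together they make
  k(\<sigma>) finite. The integral over x supplies no strictness. The sum over n is strictly smaller
  at every x, but without a uniform margin, so strictness survives integration only if the functions
  compared are finite almost everywhere and differ on a set that is not null. This is the role of
  the norms being positive and finite. The second and third inequalities are the two operator forms
  of the Schur test; the first follows from the second by Hoelder.\<close>

lemma epowr_ennreal [simp]: "x \<ge> 0 \<Longrightarrow> epowr (ennreal x) r = ennreal (x powr r)"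
  by (simp add: epowr_def)

lemma epowr_top [simp]: "epowr top r = top"
  by (simp add: epowr_def)

lemma epowr_0 [simp]: "epowr 0 r = 0"
  by (simp add: epowr_def)

lemma epowr_eq_0_iff [simp]: "epowr x r = 0 \<longleftrightarrow> x = 0"
  by (cases x) (auto simp: ennreal_eq_0_iff)

lemma epowr_pos_iff [simp]: "0 < epowr x r \<longleftrightarrow> 0 < x"
  by (metis epowr_eq_0_iff not_gr_zero)

lemma epowr_eq_top_iff [simp]: "epowr x r = top \<longleftrightarrow> x = top"
  by (cases x) auto

lemma epowr_less_top_iff [simp]: "epowr x r < top \<longleftrightarrow> x < top"
  by (metis epowr_eq_top_iff less_top)

text \<open>Every power, also a negative one, fixes 0 and \<infinity>. This matches the convention 0
  * \<infinity> = 0, so the laws of exponents hold without side conditions.\<close>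

lemma epowr_mult: "epowr (x * y) r = epowr x r * epowr y r"
proof (cases "x = 0 \<or> y = 0")
  case False
  then show ?thesis
    by (cases x; cases y)
       (auto simp: ennreal_mult_top ennreal_top_mult powr_mult simp flip: ennreal_mult)
qed auto

lemma epowr_epowr: "epowr (epowr x r) s = epowr x (r * s)"
  by (cases x) (auto simp: powr_powr)

lemma epowr_1 [simp]: "epowr x 1 = x"
  by (cases x) auto

lemma epowr_add: "epowr x (r + s) = epowr x r * epowr x s"
  by (cases x) (auto simp: powr_add ennreal_mult)

lemma epowr_strict_mono: "r > 0 \<Longrightarrow> x < y \<Longrightarrow> epowr x r < epowr y r"
  by (cases x; cases y) (auto simp: ennreal_less_iff powr_less_mono2)

lemma epowr_mono: "r > 0 \<Longrightarrow> x \<le> y \<Longrightarrow> epowr x r \<le> epowr y r"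
  using epowr_strict_mono[of r x y] by (auto simp: order.order_iff_strict)

lemma measurable_epowr [measurable]:
  assumes [measurable]: "f \<in> borel_measurable M"
  shows "(\<lambda>x. epowr (f x) r) \<in> borel_measurable M"
  unfolding epowr_def by measurable

lemma Youngs_inequality_epowr:
  assumes "p > 1" "q > 1" "1 / p + 1 / q = 1"
  shows "x * y \<le> ennreal (1 / p) * epowr x p + ennreal (1 / q) * epowr y q"
proof (cases "x = top \<or> y = top")
  case True
  then show ?thesis
    using assms by (cases "x = 0 \<or> y = 0") (auto simp: ennreal_mult_top ennreal_top_mult)
next
  case False
  then obtain a b where "x = ennreal a" "a \<ge> 0" "y = ennreal b" "b \<ge> 0"
    by (cases x; cases y) auto
  then show ?thesis
    using Youngs_inequality[OF assms, of a b] assms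
    by (simp flip: ennreal_mult ennreal_plus add: ennreal_leI)
qed

text \<open>Young's inequality is integrated after both factors are scaled to norm 1. A vanishing
  norm is treated first: the right side is then 0 even if the other norm is infinite, and the
  product on the left vanishes almost everywhere.\<close>

lemma nn_integral_Hoelder:
  assumes pq: "p > 1" "q > 1" "1 / p + 1 / q = 1"
    and [measurable]: "f \<in> borel_measurable M" "g \<in> borel_measurable M"
  shows "(\<integral>\<^sup>+x. f x * g x \<partial>M)
    \<le> epowr (\<integral>\<^sup>+x. epowr (f x) p \<partial>M) (1 / p) * epowr (\<integral>\<^sup>+x. epowr (g x) q \<partial>M) (1 / q)"
proof -
  define F G where "F = (\<integral>\<^sup>+x. epowr (f x) p \<partial>M)" and "G = (\<integral>\<^sup>+x. epowr (g x) q \<partial>M)"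
  consider "F = 0 \<or> G = 0" | "F = top \<or> G = top" "F \<noteq> 0" "G \<noteq> 0"
    | s t where "F = ennreal s" "G = ennreal t" "s > 0" "t > 0"
    by (cases F; cases G) (auto simp: less_le)
  then show ?thesis
  proof cases
    case 1
    then have "(AE x in M. f x = 0) \<or> (AE x in M. g x = 0)"
      by (auto simp: F_def G_def nn_integral_0_iff_AE)
    then have "AE x in M. f x * g x = 0"
      by auto
    then have "(\<integral>\<^sup>+x. f x * g x \<partial>M) = 0"
      by (simp add: nn_integral_0_iff_AE)
    then show ?thesis by simp
  next
    case 2
    then have "epowr F (1 / p) * epowr G (1 / q) = top"
      by (auto simp: ennreal_mult_eq_top_iff)
    then show ?thesis
      by (simp add: F_def G_def)
  next
    case 3
    define c d where "c = s powr (1 / p)" and "d = t powr (1 / q)"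
    have cd: "c > 0" "d > 0" "c powr p = s" "d powr q = t"
      using 3 pq by (auto simp: c_def d_def powr_powr)
    have "(\<integral>\<^sup>+x. (ennreal (1 / c) * f x) * (ennreal (1 / d) * g x) \<partial>M)
        \<le> (\<integral>\<^sup>+x. ennreal (1 / p) * epowr (ennreal (1 / c) * f x) p
              + ennreal (1 / q) * epowr (ennreal (1 / d) * g x) q \<partial>M)"
      by (intro nn_integral_mono Youngs_inequality_epowr pq)
    also have "\<dots> = ennreal (1 / p) * (ennreal (1 / s) * F) + ennreal (1 / q) * (ennreal (1 / t) * G)"
      using cd by (simp add: nn_integral_add nn_integral_cmult epowr_mult F_def G_def powr_divide)
    also have "\<dots> = 1"
      using 3 pq by (simp flip: ennreal_mult ennreal_plus)
    finally have *: "(\<integral>\<^sup>+x. (ennreal (1 / c) * f x) * (ennreal (1 / d) * g x) \<partial>M) \<le> 1" .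
    have "(\<integral>\<^sup>+x. f x * g x \<partial>M)
        = ennreal (c * d) * (\<integral>\<^sup>+x. (ennreal (1 / c) * f x) * (ennreal (1 / d) * g x) \<partial>M)"
    proof (subst nn_integral_cmult[symmetric], measurable, intro nn_integral_cong)
      fix x
      have "ennreal (c * d) * ((ennreal (1 / c) * f x) * (ennreal (1 / d) * g x))
          = (ennreal (c * d) * ennreal (1 / c) * ennreal (1 / d)) * (f x * g x)"
        by (simp add: mult_ac)
      also have "ennreal (c * d) * ennreal (1 / c) * ennreal (1 / d) = 1"
        using cd by (simp flip: ennreal_mult)
      finally show "f x * g x
          = ennreal (c * d) * ((ennreal (1 / c) * f x) * (ennreal (1 / d) * g x))" by simp
    qed
    also have "\<dots> \<le> ennreal (c * d) * 1"
      by (intro mult_left_mono *) auto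
    also have "\<dots> = epowr F (1 / p) * epowr G (1 / q)"
      using 3 by (simp add: c_def d_def ennreal_mult)
    finally show ?thesis
      by (simp add: F_def G_def)
  qed
qed

text \<open>Hoelder with \<open>H\<close> split as H^(1/p) H^(1/q) and a test weight
  \<open>w\<close> inserted as w^(-1/q) w^(1/q). It is the engine of both halves of the Schur test,
  with \<open>w\<close> equal to \<open>u\<close> for integrals and to \<open>v\<close> for
  sums.\<close>

lemma nn_integral_weighted_Hoelder:
  fixes w :: "'a \<Rightarrow> real"
  assumes p: "p > 1"
    and [measurable]: "H \<in> borel_measurable M" "f \<in> borel_measurable M" "w \<in> borel_measurable M"
    and w: "\<And>x. x \<in> space M \<Longrightarrow> w x > 0"
  shows "epowr (\<integral>\<^sup>+x. H x * f x \<partial>M) p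
    \<le> (\<integral>\<^sup>+x. H x * epowr (f x) p * ennreal (w x powr (1 - p)) \<partial>M)
        * epowr (\<integral>\<^sup>+x. H x * ennreal (w x) \<partial>M) (p - 1)"
proof -
  define q where "q = p / (p - 1)"
  have pq: "p > 1" "q > 1" "1 / p + 1 / q = 1" "p / q = p - 1"
    using p by (auto simp: q_def field_simps)
  have "(\<integral>\<^sup>+x. H x * f x \<partial>M)
      = (\<integral>\<^sup>+x. (epowr (H x) (1 / p) * f x * ennreal (w x powr (- 1 / q)))
              * (epowr (H x) (1 / q) * ennreal (w x powr (1 / q))) \<partial>M)"
  proof (intro nn_integral_cong)
    fix x assume x: "x \<in> space M"
    have "(epowr (H x) (1 / p) * f x * ennreal (w x powr (- 1 / q)))
              * (epowr (H x) (1 / q) * ennreal (w x powr (1 / q)))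
        = (epowr (H x) (1 / p) * epowr (H x) (1 / q)) * f x
              * (ennreal (w x powr (- 1 / q)) * ennreal (w x powr (1 / q)))"
      by (simp add: mult_ac)
    also have "epowr (H x) (1 / p) * epowr (H x) (1 / q) = H x"
      using pq by (simp flip: epowr_add)
    also have "ennreal (w x powr (- 1 / q)) * ennreal (w x powr (1 / q)) = 1"
      using w[OF x] by (simp flip: ennreal_mult powr_add)
    finally show "H x * f x = (epowr (H x) (1 / p) * f x * ennreal (w x powr (- 1 / q)))
              * (epowr (H x) (1 / q) * ennreal (w x powr (1 / q)))" by simp
  qed
  also have "\<dots> \<le> epowr (\<integral>\<^sup>+x. epowr (epowr (H x) (1 / p) * f x * ennreal (w x powr (- 1 / q))) p \<partial>M) (1 / p)
      * epowr (\<integral>\<^sup>+x. epowr (epowr (H x) (1 / q) * ennreal (w x powr (1 / q))) q \<partial>M) (1 / q)"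
    by (intro nn_integral_Hoelder pq) measurable
  also have "(\<integral>\<^sup>+x. epowr (epowr (H x) (1 / p) * f x * ennreal (w x powr (- 1 / q))) p \<partial>M)
      = (\<integral>\<^sup>+x. H x * epowr (f x) p * ennreal (w x powr (1 - p)) \<partial>M)"
    using pq by (simp add: epowr_mult epowr_epowr powr_powr)
  also have "(\<integral>\<^sup>+x. epowr (epowr (H x) (1 / q) * ennreal (w x powr (1 / q))) q \<partial>M)
      = (\<integral>\<^sup>+x. H x * ennreal (w x) \<partial>M)"
    using pq w by (intro nn_integral_cong) (simp add: epowr_mult epowr_epowr powr_powr less_imp_le)
  finally have "epowr (\<integral>\<^sup>+x. H x * f x \<partial>M) p
      \<le> epowr (epowr (\<integral>\<^sup>+x. H x * epowr (f x) p * ennreal (w x powr (1 - p)) \<partial>M) (1 / p)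
          * epowr (\<integral>\<^sup>+x. H x * ennreal (w x) \<partial>M) (1 / q)) p"
    using p by (intro epowr_mono) auto
  then show ?thesis
    using pq by (simp add: epowr_mult epowr_epowr)
qed

text \<open>A weight \<open>c\<close> in the p-norm is dual to c^(1-q) in the q-norm, since -q/p = 1
  - q. This turns a bound on an operator into one on its bilinear form.\<close>

lemma nn_integral_Hoelder_dual_weight:
  fixes c :: "'a \<Rightarrow> real"
  assumes pq: "p > 1" "q > 1" "1 / p + 1 / q = 1"
    and [measurable]: "f \<in> borel_measurable M" "g \<in> borel_measurable M" "c \<in> borel_measurable M"
    and c: "\<And>x. x \<in> space M \<Longrightarrow> c x > 0"
  shows "(\<integral>\<^sup>+x. f x * g x \<partial>M)
    \<le> epowr (\<integral>\<^sup>+x. ennreal (c x) * epowr (f x) p \<partial>M) (1 / p)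
      * epowr (\<integral>\<^sup>+x. ennreal (c x powr (1 - q)) * epowr (g x) q \<partial>M) (1 / q)"
proof -
  have q: "- (1 / p) * q = 1 - q"
    using pq by (simp add: field_simps)
  have "(\<integral>\<^sup>+x. f x * g x \<partial>M)
      = (\<integral>\<^sup>+x. (ennreal (c x powr (1 / p)) * f x) * (ennreal (c x powr - (1 / p)) * g x) \<partial>M)"
  proof (intro nn_integral_cong)
    fix x assume x: "x \<in> space M"
    have "(ennreal (c x powr (1 / p)) * f x) * (ennreal (c x powr - (1 / p)) * g x)
        = (ennreal (c x powr (1 / p)) * ennreal (c x powr - (1 / p))) * (f x * g x)"
      by (simp add: mult_ac)
    also have "ennreal (c x powr (1 / p)) * ennreal (c x powr - (1 / p)) = 1"
      using c[OF x] by (simp flip: ennreal_mult powr_add)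
    finally show "f x * g x
        = (ennreal (c x powr (1 / p)) * f x) * (ennreal (c x powr - (1 / p)) * g x)" by simp
  qed
  also have "\<dots> \<le> epowr (\<integral>\<^sup>+x. epowr (ennreal (c x powr (1 / p)) * f x) p \<partial>M) (1 / p)
      * epowr (\<integral>\<^sup>+x. epowr (ennreal (c x powr - (1 / p)) * g x) q \<partial>M) (1 / q)"
    by (intro nn_integral_Hoelder pq) measurable
  also have "(\<integral>\<^sup>+x. epowr (ennreal (c x powr (1 / p)) * f x) p \<partial>M)
      = (\<integral>\<^sup>+x. ennreal (c x) * epowr (f x) p \<partial>M)"
    using pq c by (intro nn_integral_cong) (simp add: epowr_mult powr_powr less_imp_le)
  also have "(\<integral>\<^sup>+x. epowr (ennreal (c x powr - (1 / p)) * g x) q \<partial>M)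
      = (\<integral>\<^sup>+x. ennreal (c x powr (1 - q)) * epowr (g x) q \<partial>M)"
    by (simp only: epowr_mult epowr_ennreal powr_ge_zero powr_powr q)
  finally show ?thesis .
qed

text \<open>Treating series as integrals makes Hoelder's inequality, Tonelli's theorem and the
  criterion for strict inequality available for both variables alike. Both sides are suprema of
  partial sums: over finite subsets on the left, over initial segments on the right.\<close>

lemma infsum_ennreal_eq_nn_integral:
  fixes f :: "nat \<Rightarrow> ennreal"
  shows "infsum f A = (\<integral>\<^sup>+n. f n \<partial>count_space A)"
proof (rule antisym)
  have eq: "infsum f A = (SUP F\<in>{F. finite F \<and> F \<subseteq> A}. sum f F)"
    by (intro nonneg_infsum_complete) auto
  show "infsum f A \<le> (\<integral>\<^sup>+n. f n \<partial>count_space A)"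
    unfolding eq
  proof (intro SUP_least)
    fix F assume F: "F \<in> {F. finite F \<and> F \<subseteq> A}"
    then have "sum f F = (\<integral>\<^sup>+n. f n * indicator F n \<partial>count_space A)"
      by (subst nn_integral_count_space'[of F]) (auto simp: indicator_def)
    also have "\<dots> \<le> (\<integral>\<^sup>+n. f n \<partial>count_space A)"
      by (intro nn_integral_mono) (auto simp: indicator_def)
    finally show "sum f F \<le> (\<integral>\<^sup>+n. f n \<partial>count_space A)" .
  qed
  have "(\<integral>\<^sup>+n. f n \<partial>count_space A) = (\<Sum>n. f n * indicator A n)"
    by (subst nn_integral_count_space_nat[symmetric]) (rule nn_integral_count_space_indicator, simp)
  also have "\<dots> = (SUP N. \<Sum>n<N. f n * indicator A n)"
    by (rule suminf_eq_SUP)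
  also have "\<dots> \<le> infsum f A"
  proof (intro SUP_least)
    fix N
    have "(\<Sum>n<N. f n * indicator A n) = sum f ({..<N} \<inter> A)"
      by (simp add: sum.inter_restrict indicator_def if_distrib cong: if_cong)
    also have "\<dots> \<le> infsum f A"
      unfolding eq by (intro SUP_upper) auto
    finally show "(\<Sum>n<N. f n * indicator A n) \<le> infsum f A" .
  qed
  finally show "(\<integral>\<^sup>+n. f n \<partial>count_space A) \<le> infsum f A" .
qed

section \<open>A strict weighted Schur test\<close>

text \<open>\<open>u\<close> and \<open>v\<close> are test weights, and \<open>k * P\<close> and
  \<open>k * Q\<close> bound the kernel applied to them. Strictness is asked of the sum only, and
  pointwise; this suffices for both operator bounds. The resulting norms carry the weights u^(1-p) P
  on functions and v^(1-q) Q on families.\<close>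

locale strict_Schur_test =
  fixes M :: "'a measure" and I :: "'i set" and H :: "'a \<Rightarrow> 'i \<Rightarrow> ennreal"
    and u P :: "'a \<Rightarrow> real" and v Q :: "'i \<Rightarrow> real" and k :: real
  assumes countable_I: "countable I"
    and H_measurable [measurable]: "\<And>i. i \<in> I \<Longrightarrow> (\<lambda>x. H x i) \<in> borel_measurable M"
    and u_measurable [measurable]: "u \<in> borel_measurable M"
    and P_measurable [measurable]: "P \<in> borel_measurable M"
    and pos: "\<And>x. x \<in> space M \<Longrightarrow> u x > 0" "\<And>x. x \<in> space M \<Longrightarrow> P x > 0"
      "\<And>i. i \<in> I \<Longrightarrow> v i > 0" "\<And>i. i \<in> I \<Longrightarrow> Q i > 0"
    and k_pos: "k > 0"
    and sum_less: "\<And>x. x \<in> space M \<Longrightarrow> (\<integral>\<^sup>+i. H x i * ennreal (v i) \<partial>count_space I) < ennreal (k * P x)"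
    and integral_le: "\<And>i. i \<in> I \<Longrightarrow> (\<integral>\<^sup>+x. H x i * ennreal (u x) \<partial>M) \<le> ennreal (k * Q i)"
begin

lemma sum_measurable:
  assumes "\<And>i. i \<in> I \<Longrightarrow> g i \<in> borel_measurable M"
  shows "(\<lambda>x. \<integral>\<^sup>+i. g i x \<partial>count_space I) \<in> borel_measurable M"
proof -
  interpret sigma_finite_measure "count_space I"
    by (rule sigma_finite_measure_count_space_countable[OF countable_I])
  have "(\<lambda>z. g (snd z) (fst z)) \<in> borel_measurable (M \<Otimes>\<^sub>M count_space I)"
    using assms
    by (intro measurable_compose_countable'[where f = "\<lambda>i z. g i (fst z)" and g = snd, OF _ _ countable_I])
       (auto intro: measurable_compose[OF measurable_fst])
  then show ?thesis
    using borel_measurable_nn_integral[of "\<lambda>x i. g i x" M] by (simp add: case_prod_beta')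
qed

text \<open>Weighted Hoelder at each \<open>i\<close> leaves a power of the integral of
  \<open>H u\<close>, bounded by \<open>k * Q i\<close>; the factor Q^(1-p) in the weight cancels
  it. After Tonelli the remaining sum over \<open>i\<close> is strictly below \<open>k * P x\<close>
  at each \<open>x\<close>.\<close>

theorem integral_operator_bound:
  assumes p: "p > 1" and [measurable]: "f \<in> borel_measurable M"
    and F: "F = (\<integral>\<^sup>+x. ennreal (u x powr (1 - p) * P x) * epowr (f x) p \<partial>M)" "0 < F" "F < top"
  shows "(\<integral>\<^sup>+i. ennreal (v i * Q i powr (1 - p)) * epowr (\<integral>\<^sup>+x. H x i * f x \<partial>M) p \<partial>count_space I)
    < ennreal (k powr p) * F"
proof -
  let ?w = "\<lambda>x. epowr (f x) p * ennreal (u x powr (1 - p))"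
  have "(\<integral>\<^sup>+i. ennreal (v i * Q i powr (1 - p)) * epowr (\<integral>\<^sup>+x. H x i * f x \<partial>M) p \<partial>count_space I)
      \<le> (\<integral>\<^sup>+i. ennreal (k powr (p - 1)) * (\<integral>\<^sup>+x. ?w x * (H x i * ennreal (v i)) \<partial>M) \<partial>count_space I)"
  proof (intro nn_integral_mono)
    fix i assume "i \<in> space (count_space I)"
    then have i[measurable]: "i \<in> I" by simp
    note [simp] = pos(3,4)[OF i, THEN less_imp_le]
    have "epowr (\<integral>\<^sup>+x. H x i * f x \<partial>M) p
        \<le> (\<integral>\<^sup>+x. H x i * epowr (f x) p * ennreal (u x powr (1 - p)) \<partial>M)
            * epowr (\<integral>\<^sup>+x. H x i * ennreal (u x) \<partial>M) (p - 1)"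
      by (intro nn_integral_weighted_Hoelder p pos) measurable
    also have "\<dots> \<le> (\<integral>\<^sup>+x. H x i * epowr (f x) p * ennreal (u x powr (1 - p)) \<partial>M)
            * epowr (ennreal (k * Q i)) (p - 1)"
      using p by (intro mult_left_mono epowr_mono integral_le i) auto
    also have "epowr (ennreal (k * Q i)) (p - 1) = ennreal (k powr (p - 1) * Q i powr (p - 1))"
      using k_pos by (simp add: powr_mult)
    finally have "ennreal (v i * Q i powr (1 - p)) * epowr (\<integral>\<^sup>+x. H x i * f x \<partial>M) p
        \<le> ennreal (v i * Q i powr (1 - p)) *
          ((\<integral>\<^sup>+x. H x i * epowr (f x) p * ennreal (u x powr (1 - p)) \<partial>M)
            * ennreal (k powr (p - 1) * Q i powr (p - 1)))"
      by (intro mult_left_mono) auto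
    also have "\<dots> = (ennreal (v i * Q i powr (1 - p)) * ennreal (k powr (p - 1) * Q i powr (p - 1)))
        * (\<integral>\<^sup>+x. H x i * epowr (f x) p * ennreal (u x powr (1 - p)) \<partial>M)"
      by (simp add: mult_ac)
    also have "ennreal (v i * Q i powr (1 - p)) * ennreal (k powr (p - 1) * Q i powr (p - 1))
        = ennreal (k powr (p - 1) * v i)"
    proof -
      have "Q i powr (1 - p) * Q i powr (p - 1) = 1"
        using pos(4)[OF i] by (simp flip: powr_add)
      then have "v i * Q i powr (1 - p) * (k powr (p - 1) * Q i powr (p - 1)) = k powr (p - 1) * v i"
        by (simp add: mult_ac)
      then show ?thesis
        by (simp flip: ennreal_mult)
    qed
    also have "\<dots> * (\<integral>\<^sup>+x. H x i * epowr (f x) p * ennreal (u x powr (1 - p)) \<partial>M)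
        = ennreal (k powr (p - 1)) * (\<integral>\<^sup>+x. ?w x * (H x i * ennreal (v i)) \<partial>M)"
      by (simp add: ennreal_mult mult.assoc flip: nn_integral_cmult) (simp add: mult_ac)
    finally show "ennreal (v i * Q i powr (1 - p)) * epowr (\<integral>\<^sup>+x. H x i * f x \<partial>M) p
        \<le> ennreal (k powr (p - 1)) * (\<integral>\<^sup>+x. ?w x * (H x i * ennreal (v i)) \<partial>M)" .
  qed
  also have "\<dots> = ennreal (k powr (p - 1)) * (\<integral>\<^sup>+x. ?w x * (\<integral>\<^sup>+i. H x i * ennreal (v i) \<partial>count_space I) \<partial>M)"
    using countable_I
    by (subst nn_integral_cmult)
       (auto simp: nn_integral_count_space_nn_integral[symmetric] nn_integral_cmult)
  also have "\<dots> < ennreal (k powr (p - 1)) * (\<integral>\<^sup>+x. ?w x * ennreal (k * P x) \<partial>M)"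
  proof (intro ennreal_mult_strict_left_mono nn_integral_less)
    have eq: "(\<integral>\<^sup>+x. ?w x * ennreal (k * P x) \<partial>M) = ennreal k * F"
      unfolding F using pos k_pos
      by (subst nn_integral_cmult[symmetric])
         (auto intro!: nn_integral_cong simp: ennreal_mult less_imp_le mult_ac)
    have le: "AE x in M. ?w x * (\<integral>\<^sup>+i. H x i * ennreal (v i) \<partial>count_space I) \<le> ?w x * ennreal (k * P x)"
        by (intro AE_I2 mult_left_mono less_imp_le[OF sum_less]) auto
    then show "AE x in M. ?w x * (\<integral>\<^sup>+i. H x i * ennreal (v i) \<partial>count_space I) \<le> ?w x * ennreal (k * P x)" .
    have "(\<integral>\<^sup>+x. ?w x * (\<integral>\<^sup>+i. H x i * ennreal (v i) \<partial>count_space I) \<partial>M) \<le> ennreal k * F"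
      unfolding eq[symmetric] by (intro nn_integral_mono_AE le)
    also have "\<dots> < top"
      using F by (simp add: ennreal_mult_less_top)
    finally show "(\<integral>\<^sup>+x. ?w x * (\<integral>\<^sup>+i. H x i * ennreal (v i) \<partial>count_space I) \<partial>M) \<noteq> \<infinity>"
      by simp
    \<comment> \<open>Multiplying a strict inequality by \<open>?w x\<close> keeps it strict only if
      \<open>?w x\<close> is neither 0 nor infinite. Since the larger integral
      \<open>ennreal k * F\<close> is finite, \<open>?w x\<close> is finite almost everywhere, so
      equality would force it to vanish almost everywhere, against \<open>0 < F\<close>.\<close>
    show "\<not> (AE x in M. ?w x * ennreal (k * P x) \<le> ?w x * (\<integral>\<^sup>+i. H x i * ennreal (v i) \<partial>count_space I))"
    proof
      assume A: "AE x in M. ?w x * ennreal (k * P x) \<le> ?w x * (\<integral>\<^sup>+i. H x i * ennreal (v i) \<partial>count_space I)"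
      have "AE x in M. ?w x * ennreal (k * P x) \<noteq> \<infinity>"
        using F eq by (intro nn_integral_PInf_AE) (auto simp: ennreal_mult_eq_top_iff)
      with A AE_space have "AE x in M. ?w x = 0"
      proof eventually_elim
        case (elim x)
        show ?case
        proof (rule ccontr)
          assume nz: "?w x \<noteq> 0"
          have "ennreal (k * P x) \<noteq> 0"
            using elim pos(2)[of x] k_pos by simp
          then have "?w x < top"
            using elim(3) by (metis infinity_ennreal_def ennreal_mult_eq_top_iff top.not_eq_extremum)
          then have "?w x * (\<integral>\<^sup>+i. H x i * ennreal (v i) \<partial>count_space I) < ?w x * ennreal (k * P x)"
            using nz sum_less[of x] elim by (intro ennreal_mult_strict_left_mono) (auto simp: zero_less_iff_neq_zero)
          with elim show False by simp
        qed
      qed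
      then have "(\<integral>\<^sup>+x. ?w x * ennreal (k * P x) \<partial>M) = 0"
        by (subst nn_integral_0_iff_AE) auto
      with eq F k_pos show False by simp
    qed
  qed (use k_pos sum_measurable[of "\<lambda>i x. H x i * ennreal (v i)"] in \<open>measurable, auto simp: ennreal_zero_less_mult_iff\<close>)
  also have "\<dots> = ennreal (k powr p) * F"
  proof -
    have "(\<integral>\<^sup>+x. ?w x * ennreal (k * P x) \<partial>M) = ennreal k * F"
      unfolding F using pos k_pos
      by (subst nn_integral_cmult[symmetric])
         (auto intro!: nn_integral_cong simp: ennreal_mult less_imp_le mult_ac)
    moreover have "ennreal (k powr (p - 1)) * ennreal k = ennreal (k powr p)"
      using k_pos powr_add[of k "p - 1" 1] by (simp flip: ennreal_mult)
    ultimately show ?thesis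
      by (simp flip: mult.assoc)
  qed
  finally show ?thesis .
qed

text \<open>Here strictness enters before integration: Hoelder over \<open>i\<close> leaves the
  factor (sum of \<open>H v\<close>)^(q-1), which is strictly below its bound. The other factor
  \<open>S x\<close> must be positive and finite for this to count. Positivity follows from
  \<open>H > 0\<close> and \<open>0 < N\<close>, finiteness almost everywhere from
  \<open>N < top\<close>, and \<open>M\<close> must not be null, as otherwise both sides would be
  0.\<close>

theorem sum_operator_bound:
  fixes a :: "'i \<Rightarrow> ennreal"
  assumes q: "q > 1"
    and H_pos: "\<And>x i. x \<in> space M \<Longrightarrow> i \<in> I \<Longrightarrow> H x i > 0"
    and M: "\<not> (AE x in M. False)"
    and N: "N = (\<integral>\<^sup>+i. ennreal (v i powr (1 - q) * Q i) * epowr (a i) q \<partial>count_space I)" "0 < N" "N < top"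
  shows "(\<integral>\<^sup>+x. ennreal (u x * P x powr (1 - q)) * epowr (\<integral>\<^sup>+i. H x i * a i \<partial>count_space I) q \<partial>M)
    < ennreal (k powr q) * N"
proof -
  define S where "S x = (\<integral>\<^sup>+i. H x i * epowr (a i) q * ennreal (v i powr (1 - q)) \<partial>count_space I)" for x
  have S_measurable [measurable]: "S \<in> borel_measurable M"
    unfolding S_def by (rule sum_measurable) measurable
  have T_measurable [measurable]: "(\<lambda>x. \<integral>\<^sup>+i. H x i * a i \<partial>count_space I) \<in> borel_measurable M"
    by (rule sum_measurable) measurable
  \<comment> \<open>Tonelli moves the integration over \<open>x\<close> onto
    \<open>H x i * u x\<close>, where the second Schur condition applies; a non-strict bound is
    enough here.\<close>
  have bound: "(\<integral>\<^sup>+x. ennreal (k powr (q - 1)) * (ennreal (u x) * S x) \<partial>M) \<le> ennreal (k powr q) * N"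
  proof -
    have "(\<integral>\<^sup>+x. ennreal (u x) * S x \<partial>M)
        = (\<integral>\<^sup>+i. (\<integral>\<^sup>+x. (epowr (a i) q * ennreal (v i powr (1 - q))) * (H x i * ennreal (u x)) \<partial>M) \<partial>count_space I)"
      unfolding S_def using countable_I
      by (subst nn_integral_count_space_nn_integral[symmetric])
         (auto simp: nn_integral_cmult[symmetric] mult_ac)
    also have "\<dots> = (\<integral>\<^sup>+i. (epowr (a i) q * ennreal (v i powr (1 - q))) * (\<integral>\<^sup>+x. H x i * ennreal (u x) \<partial>M) \<partial>count_space I)"
      by (intro nn_integral_cong nn_integral_cmult) auto
    also have "\<dots> \<le> (\<integral>\<^sup>+i. (epowr (a i) q * ennreal (v i powr (1 - q))) * ennreal (k * Q i) \<partial>count_space I)"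
      by (intro nn_integral_mono mult_left_mono integral_le) auto
    also have "\<dots> = ennreal k * N"
      unfolding N using pos k_pos
      by (subst nn_integral_cmult[symmetric])
         (auto intro!: nn_integral_cong simp: ennreal_mult less_imp_le mult_ac)
    finally have "(\<integral>\<^sup>+x. ennreal (u x) * S x \<partial>M) \<le> ennreal k * N" .
    then have "ennreal (k powr (q - 1)) * (\<integral>\<^sup>+x. ennreal (u x) * S x \<partial>M)
        \<le> ennreal (k powr (q - 1)) * (ennreal k * N)"
      by (intro mult_left_mono) auto
    also have "ennreal (k powr (q - 1)) * (ennreal k * N) = ennreal (k powr q) * N"
      using k_pos powr_add[of k "q - 1" 1] by (simp flip: ennreal_mult mult.assoc)
    finally show ?thesis
      by (simp add: nn_integral_cmult)
  qed
  have S_pos: "S x > 0" if x: "x \<in> space M" for x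
  proof (rule ccontr)
    assume "\<not> S x > 0"
    then have "\<forall>i\<in>I. H x i * epowr (a i) q * ennreal (v i powr (1 - q)) = 0"
      unfolding S_def by (simp add: nn_integral_0_iff_AE AE_count_space)
    then have "\<forall>i\<in>I. a i = 0"
      using H_pos[OF x] pos(3) by (fastforce simp: ennreal_eq_0_iff)
    then have "N = 0"
      unfolding N by (simp add: nn_integral_0_iff_AE AE_count_space)
    with N show False by simp
  qed
  have Hoelder: "ennreal (u x * P x powr (1 - q)) * epowr (\<integral>\<^sup>+i. H x i * a i \<partial>count_space I) q
      \<le> ennreal (u x * P x powr (1 - q)) * (S x * epowr (\<integral>\<^sup>+i. H x i * ennreal (v i) \<partial>count_space I) (q - 1))" for x
    unfolding S_def by (intro mult_left_mono nn_integral_weighted_Hoelder q) (auto simp: pos)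
  have eq: "ennreal (u x * P x powr (1 - q)) * (S x * epowr (ennreal (k * P x)) (q - 1))
      = ennreal (k powr (q - 1)) * (ennreal (u x) * S x)" if x: "x \<in> space M" for x
  proof -
    have "P x powr (1 - q) * P x powr (q - 1) = 1"
      using pos(2)[OF x] by (simp flip: powr_add)
    then have "u x * P x powr (1 - q) * (k powr (q - 1) * P x powr (q - 1)) = k powr (q - 1) * u x"
      by (simp add: mult_ac)
    then have "ennreal (u x * P x powr (1 - q)) * ennreal (k powr (q - 1) * P x powr (q - 1))
        = ennreal (k powr (q - 1)) * ennreal (u x)"
      using pos[THEN less_imp_le] x by (simp flip: ennreal_mult)
    moreover have "epowr (ennreal (k * P x)) (q - 1) = ennreal (k powr (q - 1) * P x powr (q - 1))"
      using k_pos pos(2)[OF x] by (simp add: powr_mult)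
    ultimately show ?thesis
      by (metis mult.assoc mult.commute)
  qed
  have less: "ennreal (u x * P x powr (1 - q)) * (S x * epowr (\<integral>\<^sup>+i. H x i * ennreal (v i) \<partial>count_space I) (q - 1))
      < ennreal (k powr (q - 1)) * (ennreal (u x) * S x)" if x: "x \<in> space M" "S x < top" for x
    unfolding eq[OF x(1), symmetric] using q pos(1,2)[OF x(1)] S_pos[OF x(1)] x
    by (intro ennreal_mult_strict_left_mono epowr_strict_mono sum_less)
       (auto simp: ennreal_zero_less_mult_iff)
  have le: "ennreal (u x * P x powr (1 - q)) * epowr (\<integral>\<^sup>+i. H x i * a i \<partial>count_space I) q
      \<le> ennreal (k powr (q - 1)) * (ennreal (u x) * S x)" if x: "x \<in> space M" for x
    unfolding eq[OF x, symmetric] using q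
    by (intro order.trans[OF Hoelder] mult_left_mono epowr_mono less_imp_le[OF sum_less] x) auto
  have "(\<integral>\<^sup>+x. ennreal (u x * P x powr (1 - q)) * epowr (\<integral>\<^sup>+i. H x i * a i \<partial>count_space I) q \<partial>M)
      < (\<integral>\<^sup>+x. ennreal (k powr (q - 1)) * (ennreal (u x) * S x) \<partial>M)"
  proof (intro nn_integral_less)
    have fin: "(\<integral>\<^sup>+x. ennreal (k powr (q - 1)) * (ennreal (u x) * S x) \<partial>M) < top"
      using bound N by (auto intro: le_less_trans simp: ennreal_mult_less_top)
    have "(\<integral>\<^sup>+x. ennreal (u x * P x powr (1 - q)) * epowr (\<integral>\<^sup>+i. H x i * a i \<partial>count_space I) q \<partial>M)
      \<le> (\<integral>\<^sup>+x. ennreal (k powr (q - 1)) * (ennreal (u x) * S x) \<partial>M)"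
      by (intro nn_integral_mono le)
    with fin show "(\<integral>\<^sup>+x. ennreal (u x * P x powr (1 - q)) * epowr (\<integral>\<^sup>+i. H x i * a i \<partial>count_space I) q \<partial>M) \<noteq> \<infinity>"
      by (auto simp: less_top dest: le_less_trans)
    show "\<not> (AE x in M. ennreal (k powr (q - 1)) * (ennreal (u x) * S x)
        \<le> ennreal (u x * P x powr (1 - q)) * epowr (\<integral>\<^sup>+i. H x i * a i \<partial>count_space I) q)"
    proof
      assume A: "AE x in M. ennreal (k powr (q - 1)) * (ennreal (u x) * S x)
        \<le> ennreal (u x * P x powr (1 - q)) * epowr (\<integral>\<^sup>+i. H x i * a i \<partial>count_space I) q"
      have "AE x in M. ennreal (k powr (q - 1)) * (ennreal (u x) * S x) \<noteq> \<infinity>"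
        using fin by (intro nn_integral_PInf_AE) auto
      with A AE_space have "AE x in M. False"
      proof eventually_elim
        case (elim x)
        then have "S x < top"
          using pos(1)[of x] k_pos by (auto simp: ennreal_mult_eq_top_iff less_top)
        with less[of x] Hoelder[of x] elim show False
          by (meson leD le_less_trans)
      qed
      with M show False by simp
    qed
  qed (use le in auto)
  with bound show ?thesis by simp
qed

end

section \<open>Convexity of the kernel\<close>

text \<open>Each use of Young's inequality is the tangent-line bound for the concave power at the
  midpoint \<open>m\<close>; the slopes cancel because \<open>a\<close> and \<open>b\<close> average
  to \<open>m\<close>.\<close>

lemma powr_midpoint_le:
  fixes a b \<gamma> :: real
  assumes "0 \<le> \<gamma>" "\<gamma> \<le> 1" "a > 0" "b > 0"
  shows "a powr \<gamma> + b powr \<gamma> \<le> 2 * ((a + b) / 2) powr \<gamma>"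
proof -
  define m where "m = (a + b) / 2"
  have m: "m > 0" using assms by (simp add: m_def)
  have "a powr \<gamma> * m powr (1 - \<gamma>) \<le> \<gamma> * a + (1 - \<gamma>) * m"
       "b powr \<gamma> * m powr (1 - \<gamma>) \<le> \<gamma> * b + (1 - \<gamma>) * m"
    using assms m by (auto intro!: Youngs_inequality_0)
  then have "(a powr \<gamma> + b powr \<gamma>) * m powr (1 - \<gamma>) \<le> 2 * m"
    by (simp add: m_def field_simps)
  also have "2 * m = (2 * m powr \<gamma>) * m powr (1 - \<gamma>)"
    using m by (simp flip: powr_add)
  finally show ?thesis
    using m by (simp add: m_def)
qed

definition csch_exp :: "real \<Rightarrow> real \<Rightarrow> real \<Rightarrow> real" where
  "csch_exp \<alpha> \<rho> u = csch (\<rho> * u) / exp (\<alpha> * u)"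

text \<open>This form exposes both properties used later: for \<alpha> + \<rho> > 0 a decreasing
  numerator over an increasing denominator, and a log-linear numerator, which leaves only the
  denominator to examine for log-convexity.\<close>

lemma csch_exp_eq: "csch_exp \<alpha> \<rho> u = 2 * exp (- (\<alpha> + \<rho>) * u) / (1 - exp (- 2 * \<rho> * u))"
proof -
  have "exp (\<rho> * u) * (1 - exp (- 2 * \<rho> * u)) = exp (\<rho> * u) - exp (- (\<rho> * u))"
    by (simp add: right_diff_distrib flip: exp_add)
  moreover have "exp (- (\<alpha> + \<rho>) * u) = 1 / (exp (\<alpha> * u) * exp (\<rho> * u))"
    by (simp add: distrib_right left_diff_distrib exp_diff exp_minus exp_add divide_inverse)
  moreover have "2 * (1 / (a * r)) / d = 2 / (r * d) / a" for a r d :: real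
    by simp
  ultimately show ?thesis
    unfolding csch_exp_def csch_def by metis
qed

lemma csch_exp_pos: "\<rho> > 0 \<Longrightarrow> u > 0 \<Longrightarrow> csch_exp \<alpha> \<rho> u > 0"
  by (simp add: csch_exp_eq)

lemma csch_exp_strict_antimono:
  assumes "\<rho> > 0" "\<alpha> + \<rho> > 0" "0 < u" "u < v"
  shows "csch_exp \<alpha> \<rho> v < csch_exp \<alpha> \<rho> u"
  unfolding csch_exp_eq using assms by (intro frac_less2) auto

text \<open>The exponential numerators give equality. For the denominators the claim is (1 - x^2)(1
  - y^2) \<le> (1 - xy)^2, where the two sides differ by (x - y)^2.\<close>

lemma csch_exp_log_midconvex:
  assumes "\<rho> > 0" "u > 0" "v > 0"
  shows "(csch_exp \<alpha> \<rho> ((u + v) / 2))\<^sup>2 \<le> csch_exp \<alpha> \<rho> u * csch_exp \<alpha> \<rho> v"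
proof -
  define x y where "x = exp (- \<rho> * u)" and "y = exp (- \<rho> * v)"
  have xy: "0 < x" "x < 1" "0 < y" "y < 1"
    using assms by (auto simp: x_def y_def)
  have sq: "exp (- 2 * \<rho> * u) = x\<^sup>2" "exp (- 2 * \<rho> * v) = y\<^sup>2" "exp (- 2 * \<rho> * ((u + v) / 2)) = x * y"
    by (simp_all add: x_def y_def power2_eq_square algebra_simps add_divide_distrib flip: exp_add)
  have lt: "x\<^sup>2 < 1" "y\<^sup>2 < 1" "x * y < 1"
    using xy mult_strict_mono[of x 1 y 1] by (auto simp: power_less_one_iff)
  have "(1 - x\<^sup>2) * (1 - y\<^sup>2) \<le> (1 - x * y)\<^sup>2"
    using zero_le_power2[of "x - y"] by (simp add: power2_eq_square algebra_simps)
  moreover have "(exp (- (\<alpha> + \<rho>) * ((u + v) / 2)))\<^sup>2 = exp (- (\<alpha> + \<rho>) * u) * exp (- (\<alpha> + \<rho>) * v)"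
    by (simp add: power2_eq_square algebra_simps add_divide_distrib flip: exp_add)
  ultimately show ?thesis
    unfolding csch_exp_eq sq using lt
    by (simp add: power_divide power_mult_distrib divide_left_mono)
qed

definition weighted_kernel :: "real \<Rightarrow> real \<Rightarrow> real \<Rightarrow> real \<Rightarrow> real \<Rightarrow> real" where
  "weighted_kernel \<alpha> \<rho> \<gamma> \<sigma> t = csch_exp \<alpha> \<rho> (t powr \<gamma>) * t powr (\<sigma> - 1)"

lemma weighted_kernel_pos: "\<rho> > 0 \<Longrightarrow> t > 0 \<Longrightarrow> weighted_kernel \<alpha> \<rho> \<gamma> \<sigma> t > 0"
  by (simp add: weighted_kernel_def csch_exp_pos)

lemma weighted_kernel_measurable [measurable]: "weighted_kernel \<alpha> \<rho> \<gamma> \<sigma> \<in> borel_measurable borel"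
  unfolding weighted_kernel_def csch_exp_def csch_def by measurable

lemma weighted_kernel_strict_antimono:
  assumes "\<rho> > 0" "\<alpha> + \<rho> > 0" "0 < \<gamma>" "\<sigma> \<le> 1" "0 < s" "s < t"
  shows "weighted_kernel \<alpha> \<rho> \<gamma> \<sigma> t < weighted_kernel \<alpha> \<rho> \<gamma> \<sigma> s"
  unfolding weighted_kernel_def
  using assms
  by (intro mult_less_le_imp_less csch_exp_strict_antimono powr_mono2' powr_less_mono2)
     (auto intro!: less_imp_le[OF csch_exp_pos])

text \<open>The two factors are treated separately. Concavity of t^\<gamma> puts the mean of
  \<open>u\<close> and \<open>v\<close> below m^\<gamma>, which is the right direction because
  \<open>csch_exp\<close> decreases; for the power factor, (m - s)(m + s) \<le> m^2 is raised to the
  nonpositive exponent \<sigma> - 1.\<close>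

lemma weighted_kernel_log_midconvex:
  assumes "\<rho> > 0" "\<alpha> + \<rho> > 0" "0 < \<gamma>" "\<gamma> \<le> 1" "\<sigma> \<le> 1" "0 < s" "s < m"
  shows "(weighted_kernel \<alpha> \<rho> \<gamma> \<sigma> m)\<^sup>2
    \<le> weighted_kernel \<alpha> \<rho> \<gamma> \<sigma> (m - s) * weighted_kernel \<alpha> \<rho> \<gamma> \<sigma> (m + s)"
proof -
  define u v where "u = (m - s) powr \<gamma>" and "v = (m + s) powr \<gamma>"
  have uv: "u > 0" "v > 0"
    using assms by (auto simp: u_def v_def)
  have "(u + v) / 2 \<le> m powr \<gamma>"
    using powr_midpoint_le[of \<gamma> "m - s" "m + s"] assms by (simp add: u_def v_def)
  then have "csch_exp \<alpha> \<rho> (m powr \<gamma>) \<le> csch_exp \<alpha> \<rho> ((u + v) / 2)"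
    using assms uv csch_exp_strict_antimono[of \<rho> \<alpha> "(u + v) / 2" "m powr \<gamma>"]
    by (auto simp: order.order_iff_strict)
  then have "(csch_exp \<alpha> \<rho> (m powr \<gamma>))\<^sup>2 \<le> (csch_exp \<alpha> \<rho> ((u + v) / 2))\<^sup>2"
    using assms by (intro power_mono) (auto intro!: less_imp_le csch_exp_pos)
  also have "\<dots> \<le> csch_exp \<alpha> \<rho> u * csch_exp \<alpha> \<rho> v"
    using assms uv by (intro csch_exp_log_midconvex)
  finally have 1: "(csch_exp \<alpha> \<rho> (m powr \<gamma>))\<^sup>2 \<le> csch_exp \<alpha> \<rho> u * csch_exp \<alpha> \<rho> v" .
  have "(m powr (\<sigma> - 1))\<^sup>2 = (m * m) powr (\<sigma> - 1)"
    using assms by (simp add: power2_eq_square powr_mult)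
  also have "\<dots> \<le> ((m - s) * (m + s)) powr (\<sigma> - 1)"
    using assms by (intro powr_mono2') (auto simp: algebra_simps intro: mult_strict_mono)
  also have "\<dots> = (m - s) powr (\<sigma> - 1) * (m + s) powr (\<sigma> - 1)"
    using assms by (simp add: powr_mult)
  finally have 2: "(m powr (\<sigma> - 1))\<^sup>2 \<le> (m - s) powr (\<sigma> - 1) * (m + s) powr (\<sigma> - 1)" .
  have "(csch_exp \<alpha> \<rho> (m powr \<gamma>))\<^sup>2 * (m powr (\<sigma> - 1))\<^sup>2
      \<le> (csch_exp \<alpha> \<rho> u * csch_exp \<alpha> \<rho> v) * ((m - s) powr (\<sigma> - 1) * (m + s) powr (\<sigma> - 1))"
    using assms uv by (intro mult_mono 1 2) (auto intro!: mult_nonneg_nonneg less_imp_le[OF csch_exp_pos])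
  then show ?thesis
    by (simp add: weighted_kernel_def power_mult_distrib u_def v_def mult_ac)
qed

lemma weighted_kernel_midpoint_less:
  assumes "\<rho> > 0" "\<alpha> + \<rho> > 0" "0 < \<gamma>" "\<gamma> \<le> 1" "\<sigma> \<le> 1" "0 < s" "s < m"
  shows "2 * weighted_kernel \<alpha> \<rho> \<gamma> \<sigma> m
    < weighted_kernel \<alpha> \<rho> \<gamma> \<sigma> (m - s) + weighted_kernel \<alpha> \<rho> \<gamma> \<sigma> (m + s)"
proof -
  let ?g = "weighted_kernel \<alpha> \<rho> \<gamma> \<sigma>"
  \<comment> \<open>AM-GM applied to the logarithmic convexity; it is strict because the kernel is injective.\<close>
  have neq: "?g (m - s) \<noteq> ?g (m + s)" and pos: "?g (m - s) > 0" "?g (m + s) > 0"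
    using assms weighted_kernel_strict_antimono[of \<rho> \<alpha> \<gamma> \<sigma> "m - s" "m + s"]
    by (auto intro!: weighted_kernel_pos)
  have "(2 * ?g m)\<^sup>2 \<le> 4 * (?g (m - s) * ?g (m + s))"
    using weighted_kernel_log_midconvex[OF assms] by (simp add: power_mult_distrib)
  also have "\<dots> < (?g (m - s) + ?g (m + s))\<^sup>2"
  proof -
    have "0 < (?g (m - s) - ?g (m + s))\<^sup>2" using neq by simp
    then show ?thesis by (simp add: power2_eq_square algebra_simps)
  qed
  finally show ?thesis
    by (rule power_less_imp_less_base) (use pos in simp)
qed

section \<open>Strict midpoint comparison of sums and integrals\<close>

text \<open>The integral is parametrised from the centre in both directions and the two copies are
  added, so the midpoint inequality applies under the integral sign; hence the doubling of both
  sides. Equality at \<open>s = 0\<close> concerns a null set. The bound \<open>r \<le> m\<close>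
  keeps the interval where \<open>g\<close> is nonnegative.\<close>

lemma strict_midpoint_integral_less:
  fixes g :: "real \<Rightarrow> real"
  assumes [measurable]: "g \<in> borel_measurable borel"
    and nonneg: "\<And>t. t > 0 \<Longrightarrow> g t \<ge> 0"
    and midpoint: "\<And>s. 0 < s \<Longrightarrow> s < r \<Longrightarrow> 2 * g m < g (m - s) + g (m + s)"
    and r: "0 < r" "r \<le> m"
  shows "ennreal (2 * r * g m) < (\<integral>\<^sup>+t. ennreal (g t) * indicator {m - r<..<m + r} t \<partial>lborel)"
proof -
  let ?J = "\<integral>\<^sup>+t. ennreal (g t) * indicator {m - r<..<m + r} t \<partial>lborel"
  have J1: "?J = (\<integral>\<^sup>+s. ennreal (g (m + s)) * indicator {- r<..<r} s \<partial>lborel)"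
    by (subst nn_integral_real_affine[where c = 1 and t = m])
       (auto intro!: nn_integral_cong simp: indicator_def)
  have J2: "?J = (\<integral>\<^sup>+s. ennreal (g (m - s)) * indicator {- r<..<r} s \<partial>lborel)"
    by (subst nn_integral_real_affine[where c = "-1" and t = m])
       (auto intro!: nn_integral_cong simp: indicator_def)
  have gm: "g m \<ge> 0" using nonneg r by simp
  have lhs: "2 * ennreal (2 * r * g m) = (\<integral>\<^sup>+s. ennreal (2 * g m) * indicator {- r<..<r} s \<partial>lborel)"
    using r gm by (subst nn_integral_cmult_indicator) (auto simp: mult_ac simp flip: ennreal_mult ennreal_numeral)
  have less: "(\<integral>\<^sup>+s. ennreal (2 * g m) * indicator {- r<..<r} s \<partial>lborel)
      < (\<integral>\<^sup>+s. (ennreal (g (m - s)) + ennreal (g (m + s))) * indicator {- r<..<r} s \<partial>lborel)"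
  proof (intro nn_integral_less)
    show "(\<integral>\<^sup>+s. ennreal (2 * g m) * indicator {- r<..<r} s \<partial>lborel) \<noteq> \<infinity>"
      using r gm by (subst nn_integral_cmult_indicator) (auto simp: ennreal_mult_eq_top_iff)
    have less: "2 * g m < g (m - s) + g (m + s)" if "s \<noteq> 0" "- r < s" "s < r" for s
      using midpoint[of "\<bar>s\<bar>"] that by (cases "s > 0") (auto simp: add.commute)
    have ae: "AE s in lborel. s \<noteq> (0::real)"
      by (intro AE_lborel_singleton)
    have ltg: "ennreal (2 * g m) < ennreal (g (m - s)) + ennreal (g (m + s))"
      if "s \<noteq> 0" "- r < s" "s < r" for s
      using less[OF that] that r gm nonneg by (simp add: ennreal_less_iff flip: ennreal_plus)
    from ae show "AE s in lborel. ennreal (2 * g m) * indicator {- r<..<r} s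
        \<le> (ennreal (g (m - s)) + ennreal (g (m + s))) * indicator {- r<..<r} s"
      by eventually_elim (auto simp: indicator_def intro!: less_imp_le[OF ltg])
    show "\<not> (AE s in lborel. (ennreal (g (m - s)) + ennreal (g (m + s))) * indicator {- r<..<r} s
        \<le> ennreal (2 * g m) * indicator {- r<..<r} s)"
    proof
      assume "AE s in lborel. (ennreal (g (m - s)) + ennreal (g (m + s))) * indicator {- r<..<r} s
        \<le> ennreal (2 * g m) * indicator {- r<..<r} s"
      with ae have "AE s in lborel. s \<notin> {- r<..<r}"
        by eventually_elim (auto simp: indicator_def not_less[symmetric] dest: ltg)
      then have "emeasure lborel {- r<..<r} = 0"
        by (subst (asm) AE_iff_measurable[OF _ refl]) (auto simp: greaterThanLessThan_def Int_def)
      with r show False by simp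
    qed
  qed measurable
  have rhs: "(\<integral>\<^sup>+s. (ennreal (g (m - s)) + ennreal (g (m + s))) * indicator {- r<..<r} s \<partial>lborel)
      = (\<integral>\<^sup>+s. ennreal (g (m - s)) * indicator {- r<..<r} s \<partial>lborel)
      + (\<integral>\<^sup>+s. ennreal (g (m + s)) * indicator {- r<..<r} s \<partial>lborel)"
    unfolding distrib_right by (intro nn_integral_add) auto
  have "2 * ennreal (2 * r * g m) < 2 * ?J"
    using less unfolding lhs[symmetric] rhs J1[symmetric] J2[symmetric] mult_2[of ?J] .
  then show ?thesis
    by (rule contrapos_pp) (auto simp: not_less intro: mult_left_mono)
qed

text \<open>Regarding \<open>g\<close> as a density turns the disjoint intervals into an instance of
  countable additivity. Each term is strictly smaller than its interval's mass, and finiteness of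
  the total keeps the inequality strict after summation.\<close>

lemma strict_midpoint_sum_less:
  fixes g :: "real \<Rightarrow> real" and m r :: "'i \<Rightarrow> real"
  assumes g[measurable]: "g \<in> borel_measurable borel"
    and nonneg: "\<And>t. t > 0 \<Longrightarrow> g t \<ge> 0"
    and midpoint: "\<And>s x. 0 < s \<Longrightarrow> s < x \<Longrightarrow> 2 * g x < g (x - s) + g (x + s)"
    and I: "countable I" "I \<noteq> {}"
    and r: "\<And>i. i \<in> I \<Longrightarrow> 0 < r i" "\<And>i. i \<in> I \<Longrightarrow> r i \<le> m i"
    and disj: "disjoint_family_on (\<lambda>i. {m i - r i<..<m i + r i}) I"
    and fin: "(\<integral>\<^sup>+t. ennreal (g t) * indicator {0<..} t \<partial>lborel) < top"
  shows "(\<integral>\<^sup>+i. ennreal (2 * r i * g (m i)) \<partial>count_space I)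
    < (\<integral>\<^sup>+t. ennreal (g t) * indicator {0<..} t \<partial>lborel)"
proof -
  let ?D = "density lborel (\<lambda>t. ennreal (g t))"
  let ?J = "\<lambda>i. {m i - r i<..<m i + r i}"
  have less: "ennreal (2 * r i * g (m i)) < emeasure ?D (?J i)" if "i \<in> I" for i
  proof -
    have "ennreal (2 * r i * g (m i)) < (\<integral>\<^sup>+t. ennreal (g t) * indicator (?J i) t \<partial>lborel)"
      using r[OF that] by (intro strict_midpoint_integral_less nonneg midpoint) auto
    then show ?thesis by (simp add: emeasure_density)
  qed
  have "(\<integral>\<^sup>+i. emeasure ?D (?J i) \<partial>count_space I) = emeasure ?D (\<Union>i\<in>I. ?J i)"
    using I disj by (intro emeasure_UN_countable[symmetric]) auto
  also have "\<dots> \<le> emeasure ?D {0<..}"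
    using r by (intro emeasure_mono) force+
  also have "\<dots> = (\<integral>\<^sup>+t. ennreal (g t) * indicator {0<..} t \<partial>lborel)"
    by (simp add: emeasure_density)
  finally have le: "(\<integral>\<^sup>+i. emeasure ?D (?J i) \<partial>count_space I)
    \<le> (\<integral>\<^sup>+t. ennreal (g t) * indicator {0<..} t \<partial>lborel)" .
  have "(\<integral>\<^sup>+i. ennreal (2 * r i * g (m i)) \<partial>count_space I)
      < (\<integral>\<^sup>+i. emeasure ?D (?J i) \<partial>count_space I)"
  proof (intro nn_integral_less)
    have "(\<integral>\<^sup>+i. ennreal (2 * r i * g (m i)) \<partial>count_space I)
        \<le> (\<integral>\<^sup>+i. emeasure ?D (?J i) \<partial>count_space I)"
      using less by (intro nn_integral_mono) (auto intro: less_imp_le)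
    with le fin show "(\<integral>\<^sup>+i. ennreal (2 * r i * g (m i)) \<partial>count_space I) \<noteq> \<infinity>"
      by (auto simp: top_unique)
  qed (use less I in \<open>auto simp: AE_count_space not_le intro: less_imp_le\<close>)
  with le show ?thesis by simp
qed

section \<open>The constant\<close>

lemma nn_integral_lebesgue_on_eq_integral:
  fixes f :: "real \<Rightarrow> real"
  assumes "f absolutely_integrable_on S" "S \<in> sets lebesgue" "\<And>x. x \<in> S \<Longrightarrow> f x \<ge> 0"
  shows "(\<integral>\<^sup>+x. ennreal (f x) \<partial>lebesgue_on S) = ennreal (integral S f)"
proof -
  have "integrable (lebesgue_on S) f"
    using assms(1,2) by (simp add: integrable_restrict_space set_integrable_def)
  then show ?thesis
    using assms(2,3)
    by (subst nn_integral_eq_integral) (auto simp: lebesgue_integral_eq_integral)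
qed

text \<open>Only an inequality, because the image of \<open>S\<close> may be a proper part of
  \<open>T\<close>: in the application nothing forces \<open>U\<close> to be unbounded.\<close>

lemma nn_integral_substitution_le:
  fixes g \<phi> \<phi>' :: "real \<Rightarrow> real"
  assumes g: "g absolutely_integrable_on T" "\<And>t. t \<in> T \<Longrightarrow> g t \<ge> 0"
    and S: "S \<in> sets lebesgue" and T: "T \<in> sets lebesgue"
    and deriv: "\<And>x. x \<in> S \<Longrightarrow> (\<phi> has_field_derivative \<phi>' x) (at x within S)"
    and inj: "inj_on \<phi> S" and sub: "\<phi> ` S \<subseteq> T"
  shows "(\<integral>\<^sup>+x. ennreal (\<bar>\<phi>' x\<bar> * g (\<phi> x)) \<partial>lebesgue_on S) \<le> (\<integral>\<^sup>+t. ennreal (g t) \<partial>lebesgue_on T)"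
proof -
  have "\<phi> ` S \<in> sets lebesgue"
    using deriv S
    by (intro differentiable_image_in_sets_lebesgue)
       (auto simp: differentiable_on_def differentiable_def has_field_derivative_def)
  then have 1: "g absolutely_integrable_on (\<phi> ` S)"
    using g(1) sub by (blast intro: set_integrable_subset)
  with has_absolute_integral_change_of_variables_1'[OF S deriv inj, of g "integral (\<phi> ` S) g"]
  have 2: "(\<lambda>x. \<bar>\<phi>' x\<bar> * g (\<phi> x)) absolutely_integrable_on S"
    and 3: "integral S (\<lambda>x. \<bar>\<phi>' x\<bar> * g (\<phi> x)) = integral (\<phi> ` S) g"
    by auto
  have "(\<integral>\<^sup>+x. ennreal (\<bar>\<phi>' x\<bar> * g (\<phi> x)) \<partial>lebesgue_on S) = ennreal (integral (\<phi> ` S) g)"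
    unfolding 3[symmetric] using g sub by (intro nn_integral_lebesgue_on_eq_integral 2 S) auto
  also have "\<dots> \<le> ennreal (integral T g)"
    using g sub 1 by (intro ennreal_leI integral_subset_le) (auto simp: set_lebesgue_integral_eq_integral)
  also have "\<dots> = (\<integral>\<^sup>+t. ennreal (g t) \<partial>lebesgue_on T)"
    using g T by (intro nn_integral_lebesgue_on_eq_integral[symmetric])
  finally show ?thesis .
qed

lemma absolutely_integrable_powr_exp_powr:
  fixes s c \<gamma> :: real
  assumes "s > 0" "c > 0" "\<gamma> > 0"
  shows "(\<lambda>t. t powr (s - 1) * exp (- c * t powr \<gamma>)) absolutely_integrable_on {0<..}"
proof -
  \<comment> \<open>The substitution reduces the claim to the Gamma integral at \<open>s / \<gamma>\<close>.\<close>
  define \<phi> where "\<phi> t = c * t powr \<gamma>" for t :: real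
  let ?g = "\<lambda>t::real. t powr (s / \<gamma> - 1) / exp t"
  have g: "?g absolutely_integrable_on {0..}"
    using Gamma_integral_real[of "s / \<gamma>"] assms
    by (intro nonnegative_absolutely_integrable_1) auto
  have deriv: "(\<phi> has_field_derivative (c * \<gamma> * t powr (\<gamma> - 1))) (at t within {0<..})" if "t \<in> {0<..}" for t
    unfolding \<phi>_def using that
    by (auto intro!: derivative_eq_intros)
  have image: "\<phi> ` {0<..} = {0<..}"
  proof (intro equalityI subsetI)
    fix y :: real assume "y \<in> {0<..}"
    then show "y \<in> \<phi> ` {0<..}"
      using assms by (intro image_eqI[of _ _ "(y / c) powr (1 / \<gamma>)"]) (auto simp: \<phi>_def powr_powr)
  qed (use assms in \<open>auto simp: \<phi>_def\<close>)
  have inj: "inj_on \<phi> {0<..}"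
    using assms by (intro inj_on_inverseI[where g = "\<lambda>y. (y / c) powr (1 / \<gamma>)"]) (auto simp: \<phi>_def powr_powr)
  have "?g absolutely_integrable_on \<phi> ` {0<..}"
    unfolding image by (rule set_integrable_subset[OF g]) auto
  then have "(\<lambda>t. \<bar>c * \<gamma> * t powr (\<gamma> - 1)\<bar> * ?g (\<phi> t)) absolutely_integrable_on {0<..}"
    by (rule absolutely_integrable_change_of_variables_1'[THEN iffD1, OF _ deriv inj, rotated 2]) auto
  \<comment> \<open>The extra factor undoes the constant
    \<open>c * \<gamma> * c powr (s / \<gamma> - 1)\<close> produced by the substitution.\<close>
  then have "(\<lambda>t. (1 / (c * \<gamma> * c powr (s / \<gamma> - 1))) * (\<bar>c * \<gamma> * t powr (\<gamma> - 1)\<bar> * ?g (\<phi> t)))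
      absolutely_integrable_on {0<..}"
    by (rule set_integrable_mult_right)
  then show ?thesis
  proof (rule set_integrable_cong[THEN iffD1, rotated -1])
    fix t :: real assume t: "t \<in> {0<..}"
    have "t powr (\<gamma> - 1) * (t powr \<gamma>) powr (s / \<gamma> - 1) = t powr (s - 1)"
      using assms t by (simp add: powr_powr right_diff_distrib flip: powr_add)
    moreover have "\<bar>c * \<gamma> * t powr (\<gamma> - 1)\<bar> * ?g (\<phi> t) = (c * \<gamma> * c powr (s / \<gamma> - 1))
        * (t powr (\<gamma> - 1) * (t powr \<gamma>) powr (s / \<gamma> - 1)) * exp (- c * t powr \<gamma>)"
      using assms t by (simp add: \<phi>_def powr_mult exp_minus divide_inverse abs_mult)
    ultimately show "(1 / (c * \<gamma> * c powr (s / \<gamma> - 1))) * (\<bar>c * \<gamma> * t powr (\<gamma> - 1)\<bar> * ?g (\<phi> t))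
        = t powr (s - 1) * exp (- c * t powr \<gamma>)"
      using assms by simp
  qed auto
qed

text \<open>Separates the pole 1/y at 0 from a bounded remainder, so that the kernel is dominated by
  two integrands of Gamma type.\<close>

lemma inverse_one_minus_exp_le:
  fixes y :: real
  assumes "y > 0"
  shows "1 / (1 - exp (- y)) \<le> 1 + 1 / y"
proof -
  have "1 + y \<le> exp y" by (rule exp_ge_add_one_self)
  then have "1 / (1 + y) \<ge> exp (- y)"
    using assms by (simp add: exp_minus field_simps)
  moreover have "1 - 1 / (1 + y) = y / (1 + y)"
    using assms by (simp add: field_simps)
  ultimately have "1 - exp (- y) \<ge> y / (1 + y)" by linarith
  then have "1 / (1 - exp (- y)) \<le> 1 / (y / (1 + y))"
    using assms by (intro divide_left_mono mult_pos_pos) auto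
  then show ?thesis using assms by (simp add: field_simps)
qed

lemma weighted_kernel_absolutely_integrable:
  assumes "\<rho> > 0" "\<alpha> + \<rho> > 0" "0 < \<gamma>" "\<gamma> < \<sigma>"
  shows "weighted_kernel \<alpha> \<rho> \<gamma> \<sigma> absolutely_integrable_on {0<..}"
proof (rule measurable_bounded_by_integrable_imp_absolutely_integrable)
  \<comment> \<open>The two terms come from \<open>1 + 1 / y\<close> at y = 2\<rho>t^\<gamma>. The
    pole lowers the exponent in the second term from \<sigma> to \<sigma> - \<gamma>, which must
    stay positive.\<close>
  let ?B = "\<lambda>t. 2 * (t powr (\<sigma> - 1) * exp (- (\<alpha> + \<rho>) * t powr \<gamma>))
    + (1 / \<rho>) * (t powr (\<sigma> - \<gamma> - 1) * exp (- (\<alpha> + \<rho>) * t powr \<gamma>))"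
  show "weighted_kernel \<alpha> \<rho> \<gamma> \<sigma> \<in> borel_measurable (lebesgue_on {0<..})"
    by (rule measurable_restrict_space1, rule measurable_completion) simp
  have "?B absolutely_integrable_on {0<..}"
    using assms
    by (intro set_integral_add(1) set_integrable_mult_right absolutely_integrable_powr_exp_powr) auto
  then show "?B integrable_on {0<..}"
    by (rule set_lebesgue_integral_eq_integral)
  fix t :: real assume t: "t \<in> {0<..}"
  define u where "u = t powr \<gamma>"
  have u: "u > 0" using t by (simp add: u_def)
  have "weighted_kernel \<alpha> \<rho> \<gamma> \<sigma> t
      = 2 * exp (- (\<alpha> + \<rho>) * u) * t powr (\<sigma> - 1) * (1 / (1 - exp (- (2 * \<rho> * u))))"
    by (simp add: weighted_kernel_def csch_exp_eq u_def)
  also have "\<dots> \<le> 2 * exp (- (\<alpha> + \<rho>) * u) * t powr (\<sigma> - 1) * (1 + 1 / (2 * \<rho> * u))"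
    using assms u by (intro mult_left_mono inverse_one_minus_exp_le) auto
  also have "\<dots> = ?B t"
  proof -
    have "t powr (\<sigma> - \<gamma> - 1) = t powr (\<sigma> - 1) / u"
      using t by (simp add: u_def algebra_simps flip: powr_diff)
    then show ?thesis
      using assms u by (simp add: u_def[symmetric] field_simps)
  qed
  finally show "norm (weighted_kernel \<alpha> \<rho> \<gamma> \<sigma> t) \<le> ?B t"
    using weighted_kernel_pos[of \<rho> t \<alpha> \<gamma> \<sigma>] assms t by simp
qed auto

text \<open>Two forms of the same number: the sum over \<open>n\<close> is compared with an integral
  over \<open>lborel\<close>, while the substitution in \<open>x\<close> takes place over
  \<open>lebesgue_on\<close>.\<close>

lemma k_const_eq_nn_integral:
  assumes "\<rho> > 0" "\<alpha> + \<rho> > 0" "0 < \<gamma>" "\<gamma> < \<sigma>"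
  shows "(\<integral>\<^sup>+t. ennreal (weighted_kernel \<alpha> \<rho> \<gamma> \<sigma> t) * indicator {0<..} t \<partial>lborel)
      = ennreal (k_const \<alpha> \<rho> \<gamma> \<sigma>)" (is ?lborel)
    and "(\<integral>\<^sup>+t. ennreal (weighted_kernel \<alpha> \<rho> \<gamma> \<sigma> t) \<partial>lebesgue_on {0<..})
      = ennreal (k_const \<alpha> \<rho> \<gamma> \<sigma>)" (is ?lebesgue)
proof -
  let ?g = "weighted_kernel \<alpha> \<rho> \<gamma> \<sigma>"
  have k: "k_const \<alpha> \<rho> \<gamma> \<sigma> = (LBINT t:{0<..}. ?g t)"
    by (simp add: k_const_def weighted_kernel_def csch_exp_def)
  have "set_integrable lborel {0<..} ?g"
    using weighted_kernel_absolutely_integrable[OF assms]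
    unfolding set_integrable_def by (subst (asm) integrable_completion) measurable
  then have "(\<integral>\<^sup>+t. ennreal (indicator {0<..} t * ?g t) \<partial>lborel) = ennreal (LBINT t:{0<..}. ?g t)"
    unfolding set_integrable_def set_lebesgue_integral_def using assms
    by (subst nn_integral_eq_integral) (auto simp: indicator_def less_imp_le weighted_kernel_pos)
  also have "(\<integral>\<^sup>+t. ennreal (indicator {0<..} t * ?g t) \<partial>lborel)
      = (\<integral>\<^sup>+t. ennreal (?g t) * indicator {0<..} t \<partial>lborel)"
    by (intro nn_integral_cong) (auto simp: indicator_def)
  finally show 1: ?lborel by (simp add: k)
  show ?lebesgue
    by (subst nn_integral_restrict_space) (simp_all add: nn_integral_completion 1)
qed

lemma k_const_pos:
  assumes "\<rho> > 0" "\<alpha> + \<rho> > 0" "0 < \<gamma>" "\<gamma> < \<sigma>"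
  shows "k_const \<alpha> \<rho> \<gamma> \<sigma> > 0"
proof (rule ccontr)
  assume "\<not> ?thesis"
  then have "(\<integral>\<^sup>+t. ennreal (weighted_kernel \<alpha> \<rho> \<gamma> \<sigma> t) * indicator {0<..} t \<partial>lborel) = 0"
    using k_const_eq_nn_integral(1)[OF assms] by (simp add: ennreal_neg)
  then have "AE t in lborel. ennreal (weighted_kernel \<alpha> \<rho> \<gamma> \<sigma> t) * indicator {0<..} t = 0"
    by (subst (asm) nn_integral_0_iff_AE) auto
  then have "AE t in lborel. t \<notin> {0<..<1::real}"
    by eventually_elim
       (use weighted_kernel_pos[OF assms(1)] in \<open>auto simp: indicator_def ennreal_eq_0_iff not_le split: if_splits dest: leD\<close>)
  then have "emeasure lborel {0<..<1::real} = 0"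
    by (subst (asm) AE_iff_measurable[OF _ refl]) (auto simp: greaterThanLessThan_def Int_def)
  then show False by simp
qed

section \<open>The primitive U and its derivative\<close>

lemma DERIV_U:
  fixes \<mu> :: "real \<Rightarrow> real"
  assumes cont: "continuous_on {0<..} \<mu>"
    and int: "\<And>x. x > 0 \<Longrightarrow> set_integrable lborel {0<..<x} \<mu>"
    and x: "x > 0"
  shows "(U \<mu> has_field_derivative \<mu> x) (at x)"
proof -
  \<comment> \<open>\<open>\<mu>\<close> may be singular at 0, so the fundamental theorem of
    calculus is applied on a compact interval around \<open>x\<close> that avoids 0, and the part of
    the integral up to \<open>a\<close> is a constant.\<close>
  define a b where "a = x / 2" and "b = x + 1"
  have ab: "0 < a" "a < x" "x < b" using x by (auto simp: a_def b_def)
  have "continuous_on {a..b} \<mu>"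
    using ab by (intro continuous_on_subset[OF cont]) auto
  then have "((\<lambda>y. LBINT t=a..y. \<mu> t) has_vector_derivative \<mu> x) (at x within {a..b})"
    by (rule interval_integral_FTC2[of a a b \<mu> x, rotated 2]) (use ab in \<open>linarith+\<close>)
  then have "((\<lambda>y. LBINT t=a..y. \<mu> t) has_field_derivative \<mu> x) (at x)"
    using at_within_interior[of x "{a..b}"] ab
    by (simp only: has_real_derivative_iff_has_vector_derivative interior_atLeastAtMost_real
        greaterThanLessThan_iff simp_thms)
  then have "((\<lambda>y. U \<mu> a + (LBINT t=a..y. \<mu> t)) has_field_derivative \<mu> x) (at x)"
    using DERIV_add[OF DERIV_const] by force
  moreover have "\<forall>\<^sub>F y in nhds x. U \<mu> a + (LBINT t=a..y. \<mu> t) = U \<mu> y"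
  proof -
    have "\<forall>\<^sub>F y in nhds x. y \<in> {a<..}"
      using ab by (intro eventually_nhds_in_open) auto
    then show ?thesis
    proof eventually_elim
      case (elim y)
      have "(LBINT t=0..a. \<mu> t) + (LBINT t=a..y. \<mu> t) = (LBINT t=0..y. \<mu> t)"
        using ab elim int[of y]
        by (intro interval_integral_sum)
           (auto simp: interval_lebesgue_integrable_def zero_ereal_def min_def max_def)
      then show ?case
        using ab elim by (simp add: U_def interval_lebesgue_integral_def zero_ereal_def)
    qed
  qed
  ultimately show ?thesis
    by (simp cong: DERIV_cong_ev)
qed

section \<open>Weight estimates\<close>

lemma U_nonneg: "(\<And>x. x > 0 \<Longrightarrow> \<mu> x > 0) \<Longrightarrow> U \<mu> x \<ge> 0"
  unfolding U_def set_lebesgue_integral_def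
  by (intro integral_nonneg_AE AE_I2) (auto simp: indicator_def less_imp_le)

locale weight_function =
  fixes \<mu> :: "real \<Rightarrow> real"
  assumes pos: "\<And>x. x > 0 \<Longrightarrow> \<mu> x > 0"
    and cont: "continuous_on {0<..} \<mu>"
    and int: "\<And>x. x > 0 \<Longrightarrow> set_integrable lborel {0<..<x} \<mu>"
begin

lemmas U_has_field_derivative = DERIV_U[OF cont int]

lemma U_strict_mono:
  assumes "0 < x" "x < y"
  shows "U \<mu> x < U \<mu> y"
proof (rule DERIV_pos_imp_increasing[OF assms(2)])
  fix z assume "x \<le> z" "z \<le> y"
  then have "z > 0" using assms by simp
  then show "\<exists>d. (U \<mu> has_real_derivative d) (at z) \<and> 0 < d"
    using U_has_field_derivative pos by blast
qed

lemma U_pos: "x > 0 \<Longrightarrow> U \<mu> x > 0"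
  using U_nonneg[of \<mu> "x / 2"] U_strict_mono[of "x / 2" x] pos by fastforce

lemma U_inj: "inj_on (U \<mu>) {0<..}"
  by (intro linorder_inj_onI) (auto dest: U_strict_mono)

lemma U_measurable: "U \<mu> \<in> borel_measurable (lebesgue_on {0<..})"
proof (rule continuous_imp_measurable_on_sets_lebesgue)
  show "continuous_on {0<..} (U \<mu>)"
    using U_has_field_derivative by (auto intro!: continuous_at_imp_continuous_on DERIV_isCont)
qed auto

text \<open>The kernel depends only on the product of U^\<delta> and \<open>w\<close>, which becomes
  the new variable. The weight \<mu> U^(\<delta>\<sigma>-1) is, up to the power of \<open>w\<close>,
  the Jacobian times the factor t^(\<sigma>-1) of the integrand.\<close>

lemma integral_kernel_le:
  assumes par: "\<rho> > 0" "\<alpha> + \<rho> > 0" "0 < \<gamma>" "\<gamma> < \<sigma>"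
    and \<delta>: "\<delta> \<in> {-1, 1}" and w: "w > 0"
  shows "(\<integral>\<^sup>+x. ennreal (csch_exp \<alpha> \<rho> ((U \<mu> x powr \<delta> * w) powr \<gamma>))
        * ennreal (\<mu> x * U \<mu> x powr (\<delta> * \<sigma> - 1)) \<partial>lebesgue_on {0<..})
    \<le> ennreal (k_const \<alpha> \<rho> \<gamma> \<sigma> * w powr - \<sigma>)"
proof -
  define \<phi> where "\<phi> x = U \<mu> x powr \<delta> * w" for x
  define \<phi>' where "\<phi>' x = \<delta> * U \<mu> x powr (\<delta> - 1) * \<mu> x * w" for x
  let ?g = "weighted_kernel \<alpha> \<rho> \<gamma> \<sigma>"
  have deriv: "(\<phi> has_field_derivative \<phi>' x) (at x within {0<..})" if "x \<in> {0<..}" for x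
  proof -
    have "((\<lambda>x. U \<mu> x powr \<delta>) has_field_derivative (\<delta> * U \<mu> x powr (\<delta> - 1)) * \<mu> x) (at x)"
      using DERIV_fun_powr[OF U_has_field_derivative U_pos, of x \<delta>] that by simp
    then show ?thesis
      unfolding \<phi>_def \<phi>'_def by (rule has_field_derivative_at_within[OF DERIV_cmult_right])
  qed
  have inj: "inj_on \<phi> {0<..}"
  proof (rule inj_onI)
    fix x y :: real assume xy: "x \<in> {0<..}" "y \<in> {0<..}" "\<phi> x = \<phi> y"
    \<comment> \<open>As \<delta> * \<delta> = 1, a second power with exponent \<delta> recovers
      \<open>U\<close>; this covers the increasing and the decreasing substitution at once.\<close>
    then have "(U \<mu> x powr \<delta>) powr \<delta> = (U \<mu> y powr \<delta>) powr \<delta>"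
      using w by (simp add: \<phi>_def)
    then have "U \<mu> x = U \<mu> y"
      using \<delta> xy U_pos[of x] U_pos[of y] by (auto simp: powr_powr)
    then show "x = y"
      using U_inj xy by (auto dest: inj_onD)
  qed
  have eq: "ennreal (csch_exp \<alpha> \<rho> ((U \<mu> x powr \<delta> * w) powr \<gamma>))
        * ennreal (\<mu> x * U \<mu> x powr (\<delta> * \<sigma> - 1))
      = ennreal (w powr - \<sigma>) * ennreal (\<bar>\<phi>' x\<bar> * ?g (\<phi> x))" if x: "x > 0" for x
  proof -
    let ?c = "csch_exp \<alpha> \<rho> ((U \<mu> x powr \<delta> * w) powr \<gamma>)"
    have c: "?c \<ge> 0"
      using par w U_pos[OF x] by (intro less_imp_le csch_exp_pos) auto
    have 1: "\<bar>\<phi>' x\<bar> = U \<mu> x powr (\<delta> - 1) * \<mu> x * w"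
      using \<delta> w pos[OF x] by (auto simp: \<phi>'_def abs_mult)
    have 2: "?g (\<phi> x) = ?c * (U \<mu> x powr (\<delta> * \<sigma> - \<delta>) * w powr (\<sigma> - 1))"
      by (simp add: weighted_kernel_def \<phi>_def powr_mult powr_powr right_diff_distrib)
    \<comment> \<open>The Jacobian contributes \<open>w\<close> and \<open>?g\<close> contributes
      \<open>w powr (\<sigma> - 1)\<close>, which fixes the scaling of the bound.\<close>
    have "w powr - \<sigma> * (w * w powr (\<sigma> - 1)) = 1"
      using w by (simp add: powr_mult_base flip: powr_add)
    moreover have "U \<mu> x powr (\<delta> - 1) * U \<mu> x powr (\<delta> * \<sigma> - \<delta>) = U \<mu> x powr (\<delta> * \<sigma> - 1)"
      by (simp flip: powr_add)
    moreover have "w powr - \<sigma> * (\<bar>\<phi>' x\<bar> * ?g (\<phi> x)) = (w powr - \<sigma> * (w * w powr (\<sigma> - 1)))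
        * (?c * (\<mu> x * (U \<mu> x powr (\<delta> - 1) * U \<mu> x powr (\<delta> * \<sigma> - \<delta>))))"
      unfolding 1 2 by (simp only: mult_ac)
    ultimately have "w powr - \<sigma> * (\<bar>\<phi>' x\<bar> * ?g (\<phi> x)) = ?c * (\<mu> x * U \<mu> x powr (\<delta> * \<sigma> - 1))"
      by simp
    then show ?thesis
      using c by (simp flip: ennreal_mult' ennreal_mult'')
  qed
  have "(\<integral>\<^sup>+x. ennreal (csch_exp \<alpha> \<rho> ((U \<mu> x powr \<delta> * w) powr \<gamma>))
        * ennreal (\<mu> x * U \<mu> x powr (\<delta> * \<sigma> - 1)) \<partial>lebesgue_on {0<..})
      = (\<integral>\<^sup>+x. ennreal (w powr - \<sigma>) * ennreal (\<bar>\<phi>' x\<bar> * ?g (\<phi> x)) \<partial>lebesgue_on {0<..})"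
    by (intro nn_integral_cong) (simp add: eq)
  also have "\<dots> = ennreal (w powr - \<sigma>) * (\<integral>\<^sup>+x. ennreal (\<bar>\<phi>' x\<bar> * ?g (\<phi> x)) \<partial>lebesgue_on {0<..})"
  proof (rule nn_integral_cmult)
    note [measurable] = U_measurable
    have [measurable]: "\<mu> \<in> borel_measurable (lebesgue_on {0<..})"
      by (rule continuous_imp_measurable_on_sets_lebesgue[OF cont]) auto
    show "(\<lambda>x. ennreal (\<bar>\<phi>' x\<bar> * ?g (\<phi> x))) \<in> borel_measurable (lebesgue_on {0<..})"
      unfolding \<phi>'_def \<phi>_def by measurable
  qed
  also have "\<dots> \<le> ennreal (w powr - \<sigma>) * (\<integral>\<^sup>+t. ennreal (?g t) \<partial>lebesgue_on {0<..})"
  proof -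
    have "\<phi> x > 0" if "x > 0" for x
      using w U_pos[OF that] by (simp add: \<phi>_def)
    then have "\<phi> ` {0<..} \<subseteq> {0<..}"
      by (simp add: image_subset_iff)
    moreover have "?g t \<ge> 0" if "t \<in> {0<..}" for t
      using that weighted_kernel_pos[OF par(1), of t] by (simp add: less_imp_le)
    ultimately show ?thesis
      by (intro mult_left_mono nn_integral_substitution_le[OF
            weighted_kernel_absolutely_integrable[OF par] _ _ _ deriv inj]) auto
  qed
  also have "\<dots> = ennreal (k_const \<alpha> \<rho> \<gamma> \<sigma> * w powr - \<sigma>)"
    by (subst k_const_eq_nn_integral(2)[OF par]) (simp add: ennreal_mult' mult.commute)
  finally show ?thesis .
qed

end

locale weight_sequence =
  fixes \<nu> :: "nat \<Rightarrow> real" and \<beta> :: real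
  assumes pos: "\<And>n. n \<ge> 1 \<Longrightarrow> \<nu> n > 0"
    and decreasing: "\<And>n. n \<ge> 1 \<Longrightarrow> \<nu> (n + 1) \<le> \<nu> n"
    and shift: "\<beta> \<le> \<nu> 1 / 2"
begin

lemma V_Suc: "V \<nu> (Suc n) = V \<nu> n + \<nu> (Suc n)"
  by (simp add: V_def)

text \<open>The bound on \<open>\<beta>\<close> enters at n = 1, where V_1 = \<nu>_1 and \<nu>_2
  \<le> \<nu>_1 leave at least \<nu>_1/2 - \<nu>_2/2. Afterwards each step moves the endpoint right
  by at least \<nu>_(n+1).\<close>

lemma left_endpoint_nonneg: "n \<ge> 1 \<Longrightarrow> V \<nu> n - \<beta> - \<nu> (n + 1) / 2 \<ge> 0"
proof (induction n rule: dec_induct)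
  case base
  then show ?case using shift decreasing[of 1] pos[of 1] by (simp add: V_def)
next
  case (step n)
  then show ?case using decreasing[of "n + 1"] pos[of "n + 1"] by (simp add: V_Suc)
qed

lemma shifted_V_pos: "n \<ge> 1 \<Longrightarrow> V \<nu> n - \<beta> > 0"
  using left_endpoint_nonneg[of n] pos[of "n + 1"] by simp

text \<open>Consecutive centres are \<nu>_(i+1) apart, and the adjacent half-lengths are
  \<nu>_(i+1)/2 and \<nu>_(i+2)/2, so a decreasing sequence leaves no overlap.\<close>

lemma right_endpoint_le_left_endpoint:
  assumes "1 \<le> i" "i < j"
  shows "V \<nu> i - \<beta> + \<nu> (i + 1) / 2 \<le> V \<nu> j - \<beta> - \<nu> (j + 1) / 2"
proof -
  have "Suc i \<le> j" using assms by simp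
  then show ?thesis
  proof (induction j rule: dec_induct)
    case base
    then show ?case using decreasing[of "i + 1"] assms by (simp add: V_Suc)
  next
    case (step n)
    then show ?case using decreasing[of "n + 1"] pos[of "n + 1"] by (simp add: V_Suc)
  qed
qed

lemma sum_kernel_less:
  assumes par: "\<rho> > 0" "\<alpha> + \<rho> > 0" "0 < \<gamma>" "\<gamma> < \<sigma>" and \<sigma>: "\<sigma> \<le> 1" and c: "c > 0"
  shows "(\<integral>\<^sup>+n. ennreal (csch_exp \<alpha> \<rho> ((c * (V \<nu> n - \<beta>)) powr \<gamma>))
        * ennreal (\<nu> (n + 1) * (V \<nu> n - \<beta>) powr (\<sigma> - 1)) \<partial>count_space {1..})
    < ennreal (k_const \<alpha> \<rho> \<gamma> \<sigma> * c powr - \<sigma>)"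
proof -
  let ?g = "weighted_kernel \<alpha> \<rho> \<gamma> \<sigma>"
  \<comment> \<open>Centres and half-lengths are scaled by \<open>c\<close> together, which
    preserves disjointness; \<open>2 * r n\<close> is the length of the n-th interval.\<close>
  define m r where "m n = c * (V \<nu> n - \<beta>)" and "r n = c * \<nu> (n + 1) / 2" for n
  have eq: "ennreal (csch_exp \<alpha> \<rho> ((c * (V \<nu> n - \<beta>)) powr \<gamma>))
        * ennreal (\<nu> (n + 1) * (V \<nu> n - \<beta>) powr (\<sigma> - 1))
      = ennreal (c powr - \<sigma>) * ennreal (2 * r n * ?g (m n))" if n: "n \<ge> 1" for n
  proof -
    let ?h = "csch_exp \<alpha> \<rho> ((c * (V \<nu> n - \<beta>)) powr \<gamma>)"
    have h: "?h \<ge> 0"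
      using par c shifted_V_pos[OF n] by (intro less_imp_le csch_exp_pos) auto
    have "c powr - \<sigma> * (c * c powr (\<sigma> - 1)) = 1"
      using c by (simp add: powr_mult_base flip: powr_add)
    moreover have "c powr - \<sigma> * (2 * r n * ?g (m n)) = (c powr - \<sigma> * (c * c powr (\<sigma> - 1)))
        * (?h * (\<nu> (n + 1) * (V \<nu> n - \<beta>) powr (\<sigma> - 1)))"
      by (simp add: r_def m_def weighted_kernel_def powr_mult)
    ultimately have "c powr - \<sigma> * (2 * r n * ?g (m n))
        = ?h * (\<nu> (n + 1) * (V \<nu> n - \<beta>) powr (\<sigma> - 1))"
      by simp
    then show ?thesis
      using h by (simp flip: ennreal_mult' ennreal_mult'')
  qed
  have "(\<integral>\<^sup>+n. ennreal (2 * r n * ?g (m n)) \<partial>count_space {1..})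
      < (\<integral>\<^sup>+t. ennreal (?g t) * indicator {0<..} t \<partial>lborel)"
  proof (rule strict_midpoint_sum_less)
    show "2 * ?g x < ?g (x - s) + ?g (x + s)" if "0 < s" "s < x" for s x
      using par \<sigma> that by (intro weighted_kernel_midpoint_less) auto
    show "r i > 0" if "i \<in> {1..}" for i
      using that c pos[of "i + 1"] by (simp add: r_def)
    show "r i \<le> m i" if "i \<in> {1..}" for i
      using that c left_endpoint_nonneg[of i] by (simp add: r_def m_def)
    show "disjoint_family_on (\<lambda>i. {m i - r i<..<m i + r i}) {1..}"
    proof -
      have "m i + r i \<le> m j - r j" if "1 \<le> i" "i < j" for i j
        using mult_left_mono[OF right_endpoint_le_left_endpoint[OF that], of c] c
        by (simp add: m_def r_def algebra_simps)
      then have "{m i - r i<..<m i + r i} \<inter> {m j - r j<..<m j + r j} = {}" if "1 \<le> i" "i < j" for i j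
        using that by fastforce
      then show ?thesis
        unfolding disjoint_family_on_def by (metis Int_commute atLeast_iff linorder_neqE_nat)
    qed
    show "(\<integral>\<^sup>+t. ennreal (?g t) * indicator {0<..} t \<partial>lborel) < top"
      by (simp add: k_const_eq_nn_integral(1)[OF par])
  qed (use par in \<open>auto intro!: less_imp_le[OF weighted_kernel_pos]\<close>)
  then have less: "(\<integral>\<^sup>+n. ennreal (2 * r n * ?g (m n)) \<partial>count_space {1..}) < ennreal (k_const \<alpha> \<rho> \<gamma> \<sigma>)"
    by (simp add: k_const_eq_nn_integral(1)[OF par])
  have "(\<integral>\<^sup>+n. ennreal (csch_exp \<alpha> \<rho> ((c * (V \<nu> n - \<beta>)) powr \<gamma>))
        * ennreal (\<nu> (n + 1) * (V \<nu> n - \<beta>) powr (\<sigma> - 1)) \<partial>count_space {1..})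
      = (\<integral>\<^sup>+n. ennreal (c powr - \<sigma>) * ennreal (2 * r n * ?g (m n)) \<partial>count_space {1..})"
    by (intro nn_integral_cong eq) simp
  also have "\<dots> = ennreal (c powr - \<sigma>) * (\<integral>\<^sup>+n. ennreal (2 * r n * ?g (m n)) \<partial>count_space {1..})"
    by (intro nn_integral_cmult) simp
  also have "\<dots> < ennreal (c powr - \<sigma>) * ennreal (k_const \<alpha> \<rho> \<gamma> \<sigma>)"
    using c less by (intro ennreal_mult_strict_left_mono) auto
  also have "\<dots> = ennreal (k_const \<alpha> \<rho> \<gamma> \<sigma> * c powr - \<sigma>)"
    by (simp add: ennreal_mult' mult.commute)
  finally show ?thesis .
qed

end

section \<open>Algebra of the kernel and of the weights\<close>

lemma K_ker_eq:
  assumes "U \<mu> x > 0"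
  shows "K_ker \<alpha> \<rho> \<gamma> \<delta> \<beta> \<mu> \<nu> x n
    = csch_exp \<alpha> \<rho> ((U \<mu> x powr \<delta> * (V \<nu> n - \<beta>)) powr \<gamma>)"
  by (simp add: K_ker_def csch_exp_def powr_mult powr_powr mult.assoc)

text \<open>Shows that the norms of the Schur test are those with weights \<open>\<Phi>\<close> (for
  \<open>a\<close>, \<open>b\<close>, \<open>s\<close> equal to \<mu>, U, \<delta>\<sigma>) and
  \<open>\<Psi>\<close> (for \<nu>_(n+1), V_n - \<beta>, \<sigma>, with \<open>q\<close> in place of
  \<open>p\<close>).\<close>

lemma Schur_weight_eq:
  fixes a b p s :: real
  assumes "a > 0" "b > 0"
  shows "(a * b powr (s - 1)) powr (1 - p) * b powr - s = b powr (p * (1 - s) - 1) / a powr (p - 1)"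
proof -
  have "b powr ((s - 1) * (1 - p)) * b powr - s = b powr (p * (1 - s) - 1)"
    by (simp add: algebra_simps flip: powr_add)
  moreover have "a powr (1 - p) = 1 / a powr (p - 1)"
    using powr_minus_divide[of a "p - 1"] by simp
  ultimately show ?thesis
    by (simp add: powr_mult powr_powr)
qed

text \<open>Gives the weights on the left of the second and third inequalities, which are v Q^(1-p)
  and u P^(1-q).\<close>

lemma Schur_dual_weight_eq:
  fixes a b p s :: real
  assumes "b > 0"
  shows "(a * b powr (s - 1)) * (b powr - s) powr (1 - p) = a / b powr (1 - p * s)"
proof -
  have "b powr (s - 1) * b powr (- s * (1 - p)) = b powr (- (1 - p * s))"
    by (simp add: algebra_simps flip: powr_add)
  then show ?thesis
    by (simp only: powr_powr mult.assoc divide_inverse flip: powr_minus)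
qed

section \<open>The Hilbert-type inequalities\<close>

theorem theorem3p1:
  fixes \<alpha> \<rho> \<gamma> \<sigma> \<beta> \<delta> p q :: real
    and \<mu> f :: "real \<Rightarrow> real"
    and \<nu> a :: "nat \<Rightarrow> real"
  assumes nu_pos: "\<And>n. n \<ge> 1 \<Longrightarrow> \<nu> n > 0"
    and nu_decreasing: "\<And>n. n \<ge> 1 \<Longrightarrow> \<nu> (n + 1) \<le> \<nu> n"
    and beta: "\<beta> \<le> \<nu> 1 / 2"
    and mu_pos: "\<And>x. x > 0 \<Longrightarrow> \<mu> x > 0"
    and mu_cont: "continuous_on {0<..} \<mu>"
    and U_finite: "\<And>x. x > 0 \<Longrightarrow> set_integrable lborel {0<..<x} \<mu>"
    and delta: "\<delta> \<in> {-1, 1}"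
    and rho: "\<rho> > max 0 (- \<alpha>)"
    and gamma: "0 < \<gamma>" "\<gamma> < \<sigma>"
    and sigma: "\<sigma> \<le> 1"
    and pq: "p > 1" "1 / p + 1 / q = 1"
    and f_nonneg: "\<And>x. x > 0 \<Longrightarrow> f x \<ge> 0"
    and f_meas: "f \<in> borel_measurable (lebesgue_on {0<..})"
    and a_nonneg: "\<And>n. n \<ge> 1 \<Longrightarrow> a n \<ge> 0"
    and f_norm: "0 < norm_fun p (\<Phi> p \<sigma> \<delta> \<mu>) f" "norm_fun p (\<Phi> p \<sigma> \<delta> \<mu>) f < \<infinity>"
    and a_norm: "0 < norm_seq q (\<Psi> q \<sigma> \<beta> \<nu>) a" "norm_seq q (\<Psi> q \<sigma> \<beta> \<nu>) a < \<infinity>"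
  shows
    "((\<Sum>\<^sub>\<infinity>n\<in>{1..}. \<integral>\<^sup>+x. ennreal (K_ker \<alpha> \<rho> \<gamma> \<delta> \<beta> \<mu> \<nu> x n * a n * f x) \<partial>(lebesgue_on {0<..}))
        < ennreal (k_const \<alpha> \<rho> \<gamma> \<sigma>) * norm_fun p (\<Phi> p \<sigma> \<delta> \<mu>) f * norm_seq q (\<Psi> q \<sigma> \<beta> \<nu>) a)
     \<and> (epowr (\<Sum>\<^sub>\<infinity>n\<in>{1..}. ennreal (\<nu> (n + 1) / (V \<nu> n - \<beta>) powr (1 - p * \<sigma>))
             * epowr (\<integral>\<^sup>+x. ennreal (K_ker \<alpha> \<rho> \<gamma> \<delta> \<beta> \<mu> \<nu> x n * f x) \<partial>(lebesgue_on {0<..})) p) (1 / p)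
        < ennreal (k_const \<alpha> \<rho> \<gamma> \<sigma>) * norm_fun p (\<Phi> p \<sigma> \<delta> \<mu>) f)
     \<and> (epowr (\<integral>\<^sup>+x. ennreal (\<mu> x / U \<mu> x powr (1 - q * \<delta> * \<sigma>))
             * epowr (\<Sum>\<^sub>\<infinity>n\<in>{1..}. ennreal (K_ker \<alpha> \<rho> \<gamma> \<delta> \<beta> \<mu> \<nu> x n * a n)) q \<partial>(lebesgue_on {0<..})) (1 / q)
        < ennreal (k_const \<alpha> \<rho> \<gamma> \<sigma>) * norm_seq q (\<Psi> q \<sigma> \<beta> \<nu>) a)"
proof -
  define k where "k = k_const \<alpha> \<rho> \<gamma> \<sigma>"
  define W where "W n = V \<nu> n - \<beta>" for n
  define H where "H x n = ennreal (K_ker \<alpha> \<rho> \<gamma> \<delta> \<beta> \<mu> \<nu> x n)" for x n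
  \<comment> \<open>\<open>u\<close> and \<open>v\<close> are the weights for which the substitution
    and the midpoint comparison produce the integrand of \<open>k\<close>; \<open>P\<close> and
    \<open>Q\<close> are the powers of U and W_n that scale out.\<close>
  define u P where "u x = \<mu> x * U \<mu> x powr (\<delta> * \<sigma> - 1)" and "P x = U \<mu> x powr - (\<delta> * \<sigma>)" for x
  define v Q where "v n = \<nu> (n + 1) * W n powr (\<sigma> - 1)" and "Q n = W n powr - \<sigma>" for n
  let ?M = "lebesgue_on {0<..} :: real measure" and ?I = "{1..} :: nat set"
  have par: "\<rho> > 0" "\<alpha> + \<rho> > 0" "0 < \<gamma>" "\<gamma> < \<sigma>"
    using rho gamma by auto
  have q: "q > 1"
  proof -
    have "0 < 1 / p" "1 / p < 1" using pq(1) by auto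
    then have "0 < 1 / q" "1 / q < 1" using pq(2) by linarith+
    then show ?thesis by (simp add: divide_less_eq_1)
  qed
  interpret \<mu>: weight_function \<mu>
    using mu_pos mu_cont U_finite by unfold_locales
  interpret \<nu>: weight_sequence \<nu> \<beta>
    using nu_pos nu_decreasing beta by unfold_locales
  note [measurable] = \<mu>.U_measurable f_meas
  have [measurable]: "\<mu> \<in> borel_measurable ?M"
    by (rule continuous_imp_measurable_on_sets_lebesgue[OF mu_cont]) auto
  have k: "k > 0"
    unfolding k_def by (rule k_const_pos[OF par])
  have W: "W n > 0" if "n \<ge> 1" for n
    using \<nu>.shifted_V_pos[OF that] by (simp add: W_def)
  have H_eq: "H x n = ennreal (csch_exp \<alpha> \<rho> ((U \<mu> x powr \<delta> * W n) powr \<gamma>))" if "x > 0" for x n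
    using K_ker_eq[OF \<mu>.U_pos[OF that]] by (simp add: H_def W_def)
  have K_pos: "K_ker \<alpha> \<rho> \<gamma> \<delta> \<beta> \<mu> \<nu> x n > 0" if "x > 0" "n \<ge> 1" for x n
    using K_ker_eq[OF \<mu>.U_pos[OF that(1)]] W[OF that(2)] \<mu>.U_pos[OF that(1)] par
    by (simp add: W_def csch_exp_pos)
  interpret strict_Schur_test ?M ?I H u P v Q k
  proof unfold_locales
    show "(\<lambda>x. H x i) \<in> borel_measurable ?M" for i
      unfolding H_def K_ker_def csch_def by measurable
    show "u \<in> borel_measurable ?M" "P \<in> borel_measurable ?M"
      unfolding u_def P_def by measurable
    show "u x > 0" "P x > 0" if "x \<in> space ?M" for x
      using that mu_pos[of x] \<mu>.U_pos[of x] by (auto simp: u_def P_def)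
    show "v i > 0" "Q i > 0" if "i \<in> ?I" for i
      using that nu_pos[of "i + 1"] W[of i] by (auto simp: v_def Q_def)
    show "(\<integral>\<^sup>+n. H x n * ennreal (v n) \<partial>count_space ?I) < ennreal (k * P x)" if "x \<in> space ?M" for x
    proof -
      have x: "x > 0" using that by simp
      then show ?thesis
        using \<nu>.sum_kernel_less[OF par sigma, of "U \<mu> x powr \<delta>"] \<mu>.U_pos[OF x]
        by (simp add: H_eq v_def P_def k_def W_def powr_powr)
    qed
    show "(\<integral>\<^sup>+x. H x n * ennreal (u x) \<partial>?M) \<le> ennreal (k * Q n)" if "n \<in> ?I" for n
    proof -
      have "(\<integral>\<^sup>+x. H x n * ennreal (u x) \<partial>?M)
          = (\<integral>\<^sup>+x. ennreal (csch_exp \<alpha> \<rho> ((U \<mu> x powr \<delta> * W n) powr \<gamma>))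
              * ennreal (\<mu> x * U \<mu> x powr (\<delta> * \<sigma> - 1)) \<partial>?M)"
        by (intro nn_integral_cong) (simp add: H_eq u_def)
      also have "\<dots> \<le> ennreal (k * Q n)"
        unfolding k_def Q_def using that W by (intro \<mu>.integral_kernel_le par delta) auto
      finally show ?thesis .
    qed
  qed (use k in auto)
  define F where "F = (\<integral>\<^sup>+x. ennreal (u x powr (1 - p) * P x) * epowr (ennreal (f x)) p \<partial>?M)"
  define N where "N = (\<integral>\<^sup>+n. ennreal (v n powr (1 - q) * Q n) * epowr (ennreal (a n)) q \<partial>count_space ?I)"
  define c where "c n = \<nu> (n + 1) / W n powr (1 - p * \<sigma>)" for n
  have c_pos: "c n > 0" if "n \<ge> 1" for n
    using nu_pos[of "n + 1"] W[OF that] by (simp add: c_def)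
  define T where "T n = (\<integral>\<^sup>+x. H x n * ennreal (f x) \<partial>?M)" for n
  have norm_f: "norm_fun p (\<Phi> p \<sigma> \<delta> \<mu>) f = epowr F (1 / p)"
  proof -
    have "u x powr (1 - p) * P x = \<Phi> p \<sigma> \<delta> \<mu> x" if "x > 0" for x
      using Schur_weight_eq[OF mu_pos[OF that] \<mu>.U_pos[OF that]] by (simp add: u_def P_def \<Phi>_def)
    then have "F = (\<integral>\<^sup>+x. ennreal (\<Phi> p \<sigma> \<delta> \<mu> x * f x powr p) \<partial>?M)"
      unfolding F_def by (intro nn_integral_cong) (simp add: f_nonneg ennreal_mult'')
    then show ?thesis by (simp add: norm_fun_def)
  qed
  have norm_a: "norm_seq q (\<Psi> q \<sigma> \<beta> \<nu>) a = epowr N (1 / q)"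
  proof -
    have "v n powr (1 - q) * Q n = \<Psi> q \<sigma> \<beta> \<nu> n" if "n \<ge> 1" for n
      using Schur_weight_eq[OF nu_pos[of "n + 1"] W[OF that]] by (simp add: v_def Q_def \<Psi>_def W_def)
    then have "N = (\<integral>\<^sup>+n. ennreal (\<Psi> q \<sigma> \<beta> \<nu> n * a n powr q) \<partial>count_space ?I)"
      unfolding N_def by (intro nn_integral_cong) (simp add: a_nonneg ennreal_mult'')
    then show ?thesis by (simp add: norm_seq_def infsum_ennreal_eq_nn_integral)
  qed
  have F: "0 < F" "F < top" and N: "0 < N" "N < top"
    using f_norm a_norm by (simp_all add: norm_f norm_a)
  have c_eq: "v n * Q n powr (1 - p) = c n" if "n \<ge> 1" for n
    using Schur_dual_weight_eq[OF W[OF that]] by (simp add: v_def Q_def c_def)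

  have "(\<integral>\<^sup>+n. ennreal (v n * Q n powr (1 - p)) * epowr (T n) p \<partial>count_space ?I) < ennreal (k powr p) * F"
    unfolding T_def by (rule integral_operator_bound[OF pq(1) _ F_def F]) measurable
  also have "(\<integral>\<^sup>+n. ennreal (v n * Q n powr (1 - p)) * epowr (T n) p \<partial>count_space ?I)
      = (\<integral>\<^sup>+n. ennreal (c n) * epowr (T n) p \<partial>count_space ?I)"
    by (intro nn_integral_cong) (simp add: c_eq)
  finally have "epowr (\<integral>\<^sup>+n. ennreal (c n) * epowr (T n) p \<partial>count_space ?I) (1 / p)
      < epowr (ennreal (k powr p) * F) (1 / p)"
    using pq by (intro epowr_strict_mono) auto
  also have "\<dots> = ennreal k * norm_fun p (\<Phi> p \<sigma> \<delta> \<mu>) f"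
    using k pq by (simp add: epowr_mult norm_f powr_powr)
  finally have ineq2: "epowr (\<integral>\<^sup>+n. ennreal (c n) * epowr (T n) p \<partial>count_space ?I) (1 / p)
      < ennreal k * norm_fun p (\<Phi> p \<sigma> \<delta> \<mu>) f" .

  \<comment> \<open>A null half-line would make the integral that equals \<open>k\<close>
    vanish.\<close>
  have not_null: "\<not> (AE x in ?M. False)"
  proof
    assume "AE x in ?M. False"
    then have "AE x in ?M. ennreal (weighted_kernel \<alpha> \<rho> \<gamma> \<sigma> x) = 0"
      by eventually_elim simp
    then have "(\<integral>\<^sup>+x. ennreal (weighted_kernel \<alpha> \<rho> \<gamma> \<sigma> x) \<partial>?M) = (\<integral>\<^sup>+x. 0 \<partial>?M)"
      by (rule nn_integral_cong_AE)
    with k show False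
      by (simp add: k_const_eq_nn_integral(2)[OF par] k_def)
  qed
  have "(\<integral>\<^sup>+x. ennreal (u x * P x powr (1 - q))
        * epowr (\<integral>\<^sup>+n. H x n * ennreal (a n) \<partial>count_space ?I) q \<partial>?M) < ennreal (k powr q) * N"
    by (rule sum_operator_bound[OF q _ not_null N_def N]) (simp add: H_def K_pos)
  also have "(\<integral>\<^sup>+x. ennreal (u x * P x powr (1 - q))
        * epowr (\<integral>\<^sup>+n. H x n * ennreal (a n) \<partial>count_space ?I) q \<partial>?M)
      = (\<integral>\<^sup>+x. ennreal (\<mu> x / U \<mu> x powr (1 - q * \<delta> * \<sigma>))
        * epowr (\<Sum>\<^sub>\<infinity>n\<in>?I. ennreal (K_ker \<alpha> \<rho> \<gamma> \<delta> \<beta> \<mu> \<nu> x n * a n)) q \<partial>?M)"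
  proof (intro nn_integral_cong)
    fix x assume "x \<in> space ?M"
    then have x: "x > 0" by simp
    have "u x * P x powr (1 - q) = \<mu> x / U \<mu> x powr (1 - q * \<delta> * \<sigma>)"
      using Schur_dual_weight_eq[OF \<mu>.U_pos[OF x]] by (simp add: u_def P_def mult.assoc)
    moreover have "(\<integral>\<^sup>+n. H x n * ennreal (a n) \<partial>count_space ?I)
        = (\<integral>\<^sup>+n. ennreal (K_ker \<alpha> \<rho> \<gamma> \<delta> \<beta> \<mu> \<nu> x n * a n) \<partial>count_space ?I)"
      by (intro nn_integral_cong) (simp add: H_def ennreal_mult'' a_nonneg)
    ultimately show "ennreal (u x * P x powr (1 - q))
        * epowr (\<integral>\<^sup>+n. H x n * ennreal (a n) \<partial>count_space ?I) q
      = ennreal (\<mu> x / U \<mu> x powr (1 - q * \<delta> * \<sigma>))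
        * epowr (\<Sum>\<^sub>\<infinity>n\<in>?I. ennreal (K_ker \<alpha> \<rho> \<gamma> \<delta> \<beta> \<mu> \<nu> x n * a n)) q"
      by (simp add: infsum_ennreal_eq_nn_integral)
  qed
  finally have "epowr (\<integral>\<^sup>+x. ennreal (\<mu> x / U \<mu> x powr (1 - q * \<delta> * \<sigma>))
        * epowr (\<Sum>\<^sub>\<infinity>n\<in>?I. ennreal (K_ker \<alpha> \<rho> \<gamma> \<delta> \<beta> \<mu> \<nu> x n * a n)) q \<partial>?M) (1 / q)
      < epowr (ennreal (k powr q) * N) (1 / q)"
    using q by (intro epowr_strict_mono) auto
  also have "\<dots> = ennreal k * norm_seq q (\<Psi> q \<sigma> \<beta> \<nu>) a"
    using k q by (simp add: epowr_mult norm_a powr_powr)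
  finally have ineq3: "epowr (\<integral>\<^sup>+x. ennreal (\<mu> x / U \<mu> x powr (1 - q * \<delta> * \<sigma>))
        * epowr (\<Sum>\<^sub>\<infinity>n\<in>?I. ennreal (K_ker \<alpha> \<rho> \<gamma> \<delta> \<beta> \<mu> \<nu> x n * a n)) q \<partial>?M) (1 / q)
      < ennreal k * norm_seq q (\<Psi> q \<sigma> \<beta> \<nu>) a" .

  \<comment> \<open>The bilinear form pairs \<open>T\<close> with \<open>a\<close>. Hoelder with the
    weight \<open>c\<close> of the second inequality reproduces its left side, and the dual weight
    c^(1-q) has to be recognised as the one in \<open>N\<close>.\<close>
  have "(\<integral>\<^sup>+n. T n * ennreal (a n) \<partial>count_space ?I)
      \<le> epowr (\<integral>\<^sup>+n. ennreal (c n) * epowr (T n) p \<partial>count_space ?I) (1 / p)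
        * epowr (\<integral>\<^sup>+n. ennreal (c n powr (1 - q)) * epowr (ennreal (a n)) q \<partial>count_space ?I) (1 / q)"
    by (intro nn_integral_Hoelder_dual_weight pq q) (auto simp: c_pos)
  also have "(\<integral>\<^sup>+n. ennreal (c n powr (1 - q)) * epowr (ennreal (a n)) q \<partial>count_space ?I) = N"
    unfolding N_def
  proof (intro nn_integral_cong)
    fix n assume "n \<in> space (count_space ?I)"
    then have n: "n \<ge> 1" by simp
    \<comment> \<open>For conjugate exponents pq = p + q. Hence the exponent of \<open>Q n\<close>
      in c^(1-q) returns to 1.\<close>
    have "(1 - p) * (1 - q) = 1"
      using pq q by (simp add: field_simps)
    then have "(Q n powr (1 - p)) powr (1 - q) = Q n"
      using W[OF n] by (simp add: Q_def powr_powr mult.assoc)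
    then have "c n powr (1 - q) = v n powr (1 - q) * Q n"
      by (simp add: c_eq[OF n, symmetric] powr_mult)
    then show "ennreal (c n powr (1 - q)) * epowr (ennreal (a n)) q
        = ennreal (v n powr (1 - q) * Q n) * epowr (ennreal (a n)) q" by simp
  qed
  \<comment> \<open>Strictness is inherited from the second inequality and survives the
    multiplication because \<open>N\<close> is positive and finite.\<close>
  also have "epowr (\<integral>\<^sup>+n. ennreal (c n) * epowr (T n) p \<partial>count_space ?I) (1 / p) * epowr N (1 / q)
      < ennreal k * norm_fun p (\<Phi> p \<sigma> \<delta> \<mu>) f * norm_seq q (\<Psi> q \<sigma> \<beta> \<nu>) a"
    unfolding norm_a using ineq2 N by (intro ennreal_mult_strict_right_mono) auto
  finally have ineq1: "(\<integral>\<^sup>+n. T n * ennreal (a n) \<partial>count_space ?I)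
      < ennreal k * norm_fun p (\<Phi> p \<sigma> \<delta> \<mu>) f * norm_seq q (\<Psi> q \<sigma> \<beta> \<nu>) a" .

  have T_eq: "(\<integral>\<^sup>+x. ennreal (K_ker \<alpha> \<rho> \<gamma> \<delta> \<beta> \<mu> \<nu> x n * f x) \<partial>?M) = T n" for n
    unfolding T_def H_def by (intro nn_integral_cong) (simp add: f_nonneg ennreal_mult'')
  have "(\<integral>\<^sup>+x. ennreal (K_ker \<alpha> \<rho> \<gamma> \<delta> \<beta> \<mu> \<nu> x n * a n * f x) \<partial>?M) = T n * ennreal (a n)"
    if "n \<ge> 1" for n
  proof -
    have "(\<integral>\<^sup>+x. ennreal (K_ker \<alpha> \<rho> \<gamma> \<delta> \<beta> \<mu> \<nu> x n * a n * f x) \<partial>?M)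
        = (\<integral>\<^sup>+x. (H x n * ennreal (f x)) * ennreal (a n) \<partial>?M)"
      unfolding H_def using that
      by (intro nn_integral_cong) (simp add: f_nonneg a_nonneg ennreal_mult' ennreal_mult'' mult_ac)
    also have "\<dots> = T n * ennreal (a n)"
      unfolding T_def H_def K_ker_def csch_def by (rule nn_integral_multc) measurable
    finally show ?thesis .
  qed
  then have "(\<integral>\<^sup>+n. (\<integral>\<^sup>+x. ennreal (K_ker \<alpha> \<rho> \<gamma> \<delta> \<beta> \<mu> \<nu> x n * a n * f x) \<partial>?M) \<partial>count_space ?I)
      = (\<integral>\<^sup>+n. T n * ennreal (a n) \<partial>count_space ?I)"
    by (intro nn_integral_cong) simp
  with ineq1 ineq2 ineq3 show ?thesis
    by (simp add: infsum_ennreal_eq_nn_integral T_eq c_def W_def k_def)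
qed

end
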